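(* The metric space $(\hat M,d_{\hat F})$ is not a Busemann $G$-space.
   Context: Structure. $\hat M=\mathbb R^2$ with canonical coordinates $(x^1,x^2)$ (superscripts are indices). $F_0$ is the norm on $\mathbb R^2$ whose unit sphere is the regular hexagon with vertices $\pm(0,1)$, $\pm(\sqrt3/2,1/2)$, $\pm(-\sqrt3/2,1/2)$. For $i\in\{0,\dots,11\}$ put $v_i=(\sin(\pi i/6),\cos(\pi i/6))$. $[p_1,\dots,p_n]$ denotes the concatenation of the oriented Euclidean segments $[p_1,p_2],\dots,[p_{n-1},p_n]$, and $\ell_E$ is Euclidean length. Fix $\hat\theta\in(\pi/3,\pi/2]$. For $p\in\hat M$, $A(p)$ is the set of $q\ne p$ such that the Euclidean angle between $q-p$ and $(0,1)$ is at most $\hat\theta$. Let $a,b,c,d\in\mathbb R^2$ be such that $b-a,\ c-b,\ d-c,\ a-d$ are positive multiples of $v_8,v_6,v_2,v_{10}$ respectively and $d-b$ is a positive multiple of $(\sin\hat\theta,\cos\hat\theta)$ (such a trapezoid exists and is unique up to Euclidean homothety); put $L_{\hat\theta}=\ell_E([d,a,b,c])/\ell_E([c,d])>1$. Let $f:\hat M\to\mathbb R$ be a continuous positive function such that $f(q)<f(p)$ whenever $q\in A(p)$, and $f(x)\in(1,L_{\hat\theta})$ for all $x\in\hat M$. Put $\hat F(x,y)=f(x)F_0(y)$ for $x\in\hat M$, $y\in T_x\hat M=\mathbb R^2$. For a piecewise smooth $\gamma:[t_0,s_0]\to\hat M$, $\ell_{\hat F}(\gamma)=\int_{t_0}^{s_0}\hat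 F(\gamma(t),\gamma'(t))\,dt$; $d_{\hat F}(p,q)$ is the infimum of $\ell_{\hat F}$ over piecewise smooth paths from $p$ to $q$. A Busemann $G$-space is a metric space $(X,d_X)$ such that: (1) every bounded subset with infinitely many points has an accumulation point; (2) for distinct $a,b\in X$ there is $c\in X\setminus\{a,b\}$ with $d_X(a,c)+d_X(c,b)=d_X(a,b)$; (3) for every $p\in X$ there is $\rho>0$ such that for all distinct $a,b\in X$ with $d_X(p,a)<\rho$, $d_X(p,b)<\rho$ there is $c\in X\setminus\{a,b\}$ with $d_X(a,b)+d_X(b,c)=d_X(a,c)$; (4) if $a,b\in X$ are distinct and $c_1,c_2\in X\setminus\{a,b\}$ satisfy $d_X(a,b)+d_X(b,c_i)=d_X(a,c_i)$ for $i=1,2$ and $d_X(b,c_1)=d_X(b,c_2)$, then $c_1=c_2$. *)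

theory Defs
  imports "HOL-Analysis.Analysis"
begin

section \<open>Busemann $G$-spaces\<close>

definition Busemann_G_space :: "'a set \<Rightarrow> ('a \<Rightarrow> 'a \<Rightarrow> real) \<Rightarrow> bool" where
  "Busemann_G_space X d \<longleftrightarrow>
     Metric_space X d \<and>
     (\<forall>S. Metric_space.mbounded X d S \<and> infinite S \<longrightarrow>
        Metric_space.mtopology X d derived_set_of S \<noteq> {}) \<and>
     (\<forall>a\<in>X. \<forall>b\<in>X. a \<noteq> b \<longrightarrow>
        (\<exists>c\<in>X - {a, b}. d a c + d c b = d a b)) \<and>
     (\<forall>p\<in>X. \<exists>\<rho>>0. \<forall>a\<in>X. \<forall>b\<in>X. a \<noteq> b \<and> d p a < \<rho> \<and> d p b < \<rho> \<longrightarrow>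
        (\<exists>c\<in>X - {a, b}. d a b + d b c = d a c)) \<and>
     (\<forall>a\<in>X. \<forall>b\<in>X. \<forall>c1\<in>X - {a, b}. \<forall>c2\<in>X - {a, b}.
        a \<noteq> b \<and> d a b + d b c1 = d a c1 \<and> d a b + d b c2 = d a c2 \<and> d b c1 = d b c2
        \<longrightarrow> c1 = c2)"

section \<open>Piecewise smooth paths, length and distance\<close>

text \<open>
  Smoothness on a compact interval means derivatives of all orders, one-sided at the end points.
\<close>

definition smooth_on_segment :: "(real \<Rightarrow> 'a::real_normed_vector) \<Rightarrow> real \<Rightarrow> real \<Rightarrow> bool" where
  "smooth_on_segment \<gamma> u v \<longleftrightarrow>
     (\<exists>D :: nat \<Rightarrow> real \<Rightarrow> 'a.
        (\<forall>t\<in>{u..v}. D 0 t = \<gamma> t) \<and>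
        (\<forall>n. \<forall>t\<in>{u..v}. (D n has_vector_derivative D (Suc n) t) (at t within {u..v})))"

text \<open>
  The library's \<open>valid_path\<close> (via \<open>piecewise_C1_differentiable_on\<close>) puts no condition on the
  one-sided derivatives at break points.  It therefore admits non-rectifiable paths, whose speed is
  not integrable; \<open>integral\<close> would give these the default value 0.  Here each piece is smooth
  up to and including its end points, so the speed is bounded.
\<close>

definition piecewise_smooth_path :: "(real \<Rightarrow> 'a::real_normed_vector) \<Rightarrow> real \<Rightarrow> real \<Rightarrow> bool" where
  "piecewise_smooth_path \<gamma> t0 s0 \<longleftrightarrow>
     t0 < s0 \<and>
     (\<exists>(n::nat) \<tau>. \<tau> 0 = t0 \<and> \<tau> n = s0 \<and>
        (\<forall>i<n. \<tau> i < \<tau> (Suc i) \<and> smooth_on_segment \<gamma> (\<tau> i) (\<tau> (Suc i))))"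

text \<open>
  At the finitely many break points \<open>vector_derivative\<close> may be an arbitrary vector, which does not
  affect the integral.
\<close>

definition finsler_length ::
  "('a::real_normed_vector \<Rightarrow> 'a \<Rightarrow> real) \<Rightarrow> (real \<Rightarrow> 'a) \<Rightarrow> real \<Rightarrow> real \<Rightarrow> real" where
  "finsler_length F \<gamma> t0 s0 =
     integral {t0..s0} (\<lambda>t. F (\<gamma> t) (vector_derivative \<gamma> (at t within {t0..s0})))"

definition finsler_dist ::
  "('a::real_normed_vector \<Rightarrow> 'a \<Rightarrow> real) \<Rightarrow> 'a \<Rightarrow> 'a \<Rightarrow> real" where
  "finsler_dist F p q =
     Inf {finsler_length F \<gamma> t0 s0 | \<gamma> t0 s0.
            piecewise_smooth_path \<gamma> t0 s0 \<and> \<gamma> t0 = p \<and> \<gamma> s0 = q}"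

section \<open>Norms and the hexagon\<close>

definition is_norm :: "('a::real_vector \<Rightarrow> real) \<Rightarrow> bool" where
  "is_norm N \<longleftrightarrow>
     (\<forall>x. 0 \<le> N x) \<and> (\<forall>x. N x = 0 \<longleftrightarrow> x = 0) \<and>
     (\<forall>c x. N (c *\<^sub>R x) = \<bar>c\<bar> * N x) \<and> (\<forall>x y. N (x + y) \<le> N x + N y)"

definition hexagon_vertices :: "(real^2) set" where
  "hexagon_vertices =
     {vector [0, 1], - vector [0, 1],
      vector [sqrt 3 / 2, 1 / 2], - vector [sqrt 3 / 2, 1 / 2],
      vector [- sqrt 3 / 2, 1 / 2], - vector [- sqrt 3 / 2, 1 / 2]}"

definition hexagon :: "(real^2) set" where
  "hexagon = frontier (convex hull hexagon_vertices)"

section \<open>Plane Euclidean geometry\<close>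

definition vdir :: "nat \<Rightarrow> real^2" where
  "vdir i = vector [sin (pi * real i / 6), cos (pi * real i / 6)]"

definition positive_multiple :: "'a::real_vector \<Rightarrow> 'a \<Rightarrow> bool" where
  "positive_multiple u w \<longleftrightarrow> (\<exists>t>0. u = t *\<^sub>R w)"

definition euclidean_angle :: "'a::real_inner \<Rightarrow> 'a \<Rightarrow> real" where
  "euclidean_angle u w = arccos (u \<bullet> w / (norm u * norm w))"

definition cone_at :: "real \<Rightarrow> real^2 \<Rightarrow> (real^2) set" where
  "cone_at \<theta> p = {q. q \<noteq> p \<and> euclidean_angle (q - p) (vector [0, 1]) \<le> \<theta>}"

fun polyline_length :: "'a::metric_space list \<Rightarrow> real" where
  "polyline_length (p # q # ps) = dist p q + polyline_length (q # ps)"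
| "polyline_length _ = 0"

definition is_trapezoid ::
  "real \<Rightarrow> real^2 \<Rightarrow> real^2 \<Rightarrow> real^2 \<Rightarrow> real^2 \<Rightarrow> bool" where
  "is_trapezoid \<theta> a b c d \<longleftrightarrow>
     positive_multiple (b - a) (vdir 8) \<and> positive_multiple (c - b) (vdir 6) \<and>
     positive_multiple (d - c) (vdir 2) \<and> positive_multiple (a - d) (vdir 10) \<and>
     positive_multiple (d - b) (vector [sin \<theta>, cos \<theta>])"

end

(*
  Prolongation is not unique: the vertical segment from - vdir 0 to 0 extends as a shortest path both
  along vdir 0 and along vdir 2, since moving up first makes f small as early as possible.  Each of
  the two curves is calibrated: there is a function H that grows along the curve exactly by arc length
  and is 1-Lipschitz for the Finsler metric.  H is built from a function lam whose level lines have
  directions in the cone, so that f at a point is at least f at the point of the curve on the same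
  level; integrating f along the curve up to level lam gives H, up to a correction term
  for which 1 < f < L leaves room.
*)
theory Submission
  imports Defs
begin

text \<open>A corner costs nothing for the norm itself: between \<open>vdir 0\<close> and
  \<open>vdir 2\<close> the hexagon has a flat side, where \<open>hexnorm\<close> is the linear
  functional \<open>hex_u + hex_v\<close>, so all paths monotone in both coordinates tie and only
  \<open>f\<close> decides between them. The delicate place is the region above the second leg,
  where \<open>hex_u > 0\<close>. A point there has to be carried to the leg by a direction in the
  cone, yet no direction within pi/3 of the vertical decreases \<open>hex_u\<close>. This calls for
  \<open>\<theta> > pi / 3\<close> and for the extreme direction on the right,
  \<open>K *\<^sub>R vdir 2 - vdir 0\<close> up to scaling. The trapezoid encodes it: its diagonal
  is parallel to it, and its side ratio gives \<open>L = 1 + 1 / K\<close>. Hence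
  \<open>f < L\<close> says \<open>(f - 1) * K < 1\<close>, which keeps the weights in the
  calibration inequality nonnegative. Uniqueness of prolongation compares end points at equal
  distance, so the second leg is cut off where its length equals that of the vertical prolongation;
  the lower bound on \<open>f\<close> guarantees that it gets that long.\<close>

section \<open>The hexagonal norm\<close>

text \<open>Coordinates with respect to the basis \<open>vdir 0\<close>, \<open>vdir 2\<close>.\<close>

definition hex_u :: "real^2 \<Rightarrow> real" where
  "hex_u x = x $ 2 - x $ 1 / sqrt 3"

definition hex_v :: "real^2 \<Rightarrow> real" where
  "hex_v x = 2 * x $ 1 / sqrt 3"

text \<open>Each of the three functionals is constant on two opposite sides of the hexagon, so the
  unit ball is an intersection of three strips. Estimates against \<open>hexnorm\<close> thus reduce
  to linear ones.\<close>

definition hexnorm :: "real^2 \<Rightarrow> real" where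
  "hexnorm x = max \<bar>hex_u x\<bar> (max \<bar>hex_v x\<bar> \<bar>hex_u x + hex_v x\<bar>)"

lemma hex_uv_simps [simp]:
  "hex_u (x + y) = hex_u x + hex_u y" "hex_v (x + y) = hex_v x + hex_v y"
  "hex_u (x - y) = hex_u x - hex_u y" "hex_v (x - y) = hex_v x - hex_v y"
  "hex_u (- x) = - hex_u x" "hex_v (- x) = - hex_v x"
  "hex_u (r *\<^sub>R x) = r * hex_u x" "hex_v (r *\<^sub>R x) = r * hex_v x"
  "hex_u 0 = 0" "hex_v 0 = 0"
  by (simp_all add: hex_u_def hex_v_def add_divide_distrib diff_divide_distrib algebra_simps)

lemma vdir_0: "vdir 0 = vector [0, 1]"
  by (simp add: vdir_def)

lemma vdir_2: "vdir 2 = vector [sqrt 3 / 2, 1 / 2]"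
proof -
  have "pi * real 2 / 6 = pi / 3" by simp
  then show ?thesis by (simp only: vdir_def sin_60 cos_60)
qed

lemma vdir_4: "vdir 4 = vdir 2 - vdir 0"
proof -
  have "pi * real 4 / 6 = pi - pi / 3" by simp
  then show ?thesis
    by (simp only: vdir_def sin_pi_minus cos_pi_minus)
       (simp add: vec_eq_iff forall_2 sin_60 cos_60)
qed

lemma vdir_add_6: "vdir (i + 6) = - vdir i"
proof -
  have "pi * real (i + 6) / 6 = pi * real i / 6 + pi" by (simp add: field_simps)
  then show ?thesis
    by (simp only: vdir_def sin_periodic_pi cos_periodic_pi) (simp add: vec_eq_iff forall_2)
qed

lemma vdir_6: "vdir 6 = - vdir 0" and vdir_8: "vdir 8 = - vdir 2"
  and vdir_10: "vdir 10 = vdir 0 - vdir 2"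
  using vdir_add_6[of 0] vdir_add_6[of 2] vdir_add_6[of 4] by (simp_all add: vdir_4)

lemma hex_uv_vdir [simp]:
  "hex_u (vdir 0) = 1" "hex_v (vdir 0) = 0" "hex_u (vdir 2) = 0" "hex_v (vdir 2) = 1"
  by (simp_all add: vdir_0 vdir_2 hex_u_def hex_v_def)

lemma hex_decomp: "hex_u x *\<^sub>R vdir 0 + hex_v x *\<^sub>R vdir 2 = x"
  by (simp add: vdir_0 vdir_2 vec_eq_iff forall_2 hex_u_def hex_v_def)

lemma hex_eqI: "hex_u x = hex_u y \<Longrightarrow> hex_v x = hex_v y \<Longrightarrow> x = y"
  by (metis hex_decomp)

lemma hexnorm_bounds:
  "hex_u x \<le> hexnorm x" "hex_v x \<le> hexnorm x" "hex_u x + hex_v x \<le> hexnorm x"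
  "- hex_u x \<le> hexnorm x" "- hex_v x \<le> hexnorm x" "- (hex_u x + hex_v x) \<le> hexnorm x"
  by (auto simp: hexnorm_def)

lemma hexnorm_leI:
  "\<bar>hex_u x\<bar> \<le> r \<Longrightarrow> \<bar>hex_v x\<bar> \<le> r \<Longrightarrow> \<bar>hex_u x + hex_v x\<bar> \<le> r \<Longrightarrow> hexnorm x \<le> r"
  by (simp add: hexnorm_def)

lemma hexnorm_nonneg [simp]: "0 \<le> hexnorm x"
  by (simp add: hexnorm_def)

lemma hexnorm_minus [simp]: "hexnorm (- x) = hexnorm x"
  using abs_minus_cancel[of "hex_u x + hex_v x"] by (simp add: hexnorm_def)

lemma hexnorm_scaleR: "0 \<le> r \<Longrightarrow> hexnorm (r *\<^sub>R x) = r * hexnorm x"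
  unfolding hexnorm_def hex_uv_simps distrib_left[symmetric] abs_mult
  by (simp add: max_mult_distrib_left)

lemma hexnorm_triangle: "hexnorm (x + y) \<le> hexnorm x + hexnorm y"
  using hexnorm_bounds[of x] hexnorm_bounds[of y]
  by (intro hexnorm_leI) (auto simp: abs_le_iff)

lemma continuous_on_hex [continuous_intros]:
  assumes "continuous_on S g"
  shows "continuous_on S (\<lambda>x. hex_u (g x))" "continuous_on S (\<lambda>x. hex_v (g x))"
    "continuous_on S (\<lambda>x. hexnorm (g x))"
  unfolding hexnorm_def hex_u_def hex_v_def using assms by (auto intro!: continuous_intros)

lemma hex_neg_vertex: "vector [- sqrt 3 / 2, 1 / 2] = vdir 0 - vdir 2"
  by (simp add: vdir_0 vdir_2 vec_eq_iff forall_2)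

lemma hexagon_vertices_eq:
  "hexagon_vertices = {vdir 0, - vdir 0, vdir 2, - vdir 2, vdir 0 - vdir 2, - (vdir 0 - vdir 2)}"
  unfolding hexagon_vertices_def hex_neg_vertex vdir_0 [symmetric] vdir_2 [symmetric] ..

lemma hexnorm_vertex: "w \<in> hexagon_vertices \<Longrightarrow> hexnorm w = 1"
  by (auto simp: hexagon_vertices_eq hexnorm_def)

lemma hexnorm_le_1_hull: "x \<in> convex hull hexagon_vertices \<Longrightarrow> hexnorm x \<le> 1"
proof -
  have "convex {x. hexnorm x \<le> 1}"
  proof (rule convexI)
    fix x y :: "real^2" and p q :: real
    assume xy: "x \<in> {x. hexnorm x \<le> 1}" "y \<in> {x. hexnorm x \<le> 1}" and pq: "0 \<le> p" "0 \<le> q" "p + q = 1"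
    have "hexnorm (p *\<^sub>R x + q *\<^sub>R y) \<le> p * hexnorm x + q * hexnorm y"
      using hexnorm_triangle[of "p *\<^sub>R x" "q *\<^sub>R y"] pq by (simp add: hexnorm_scaleR)
    also have "\<dots> \<le> p * 1 + q * 1"
      using xy pq by (intro add_mono mult_left_mono) auto
    finally show "p *\<^sub>R x + q *\<^sub>R y \<in> {x. hexnorm x \<le> 1}" using pq by simp
  qed
  then have "convex hull hexagon_vertices \<subseteq> {x. hexnorm x \<le> 1}"
    by (intro hull_minimal) (auto simp: hexnorm_vertex)
  then show "x \<in> convex hull hexagon_vertices \<Longrightarrow> hexnorm x \<le> 1" by auto
qed

text \<open>Pushing a vertex radially outwards makes \<open>hexnorm\<close> exceed 1 and so leaves
  the hull; hence no vertex is interior.\<close>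

lemma vertex_in_hexagon:
  assumes "w \<in> hexagon_vertices"
  shows "w \<in> hexagon"
proof -
  have w: "w \<in> convex hull hexagon_vertices" using assms by (rule hull_inc)
  have "w \<noteq> 0" using hexnorm_vertex[OF assms] by (auto simp: hexnorm_def)
  have "w \<notin> interior (convex hull hexagon_vertices)"
  proof
    assume "w \<in> interior (convex hull hexagon_vertices)"
    then obtain e where e: "e > 0" "ball w e \<subseteq> convex hull hexagon_vertices"
      by (meson mem_interior)
    define s where "s = e / (2 * norm w)"
    have s: "s > 0" using e \<open>w \<noteq> 0\<close> by (simp add: s_def)
    have "dist w ((1 + s) *\<^sub>R w) = s * norm w"
      using s by (simp add: dist_norm algebra_simps)
    also have "\<dots> < e" using e \<open>w \<noteq> 0\<close> by (simp add: s_def)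
    finally have "(1 + s) *\<^sub>R w \<in> convex hull hexagon_vertices" using e by auto
    then have "hexnorm ((1 + s) *\<^sub>R w) \<le> 1" by (rule hexnorm_le_1_hull)
    then show False using s hexnorm_vertex[OF assms] by (simp add: hexnorm_scaleR)
  qed
  then show ?thesis
    using w closure_subset unfolding hexagon_def frontier_def by blast
qed

text \<open>Upper bound: \<open>N\<close> is 1 at the vertices, and \<open>x\<close> is expanded in
  three bases of neighbouring vertices; in every sign pattern of the coordinates one of the three
  resulting bounds is at most \<open>hexnorm x\<close>. Lower bound: \<open>x\<close> scaled to
  \<open>N\<close>-norm 1 lies in the hull, where \<open>hexnorm\<close> is at most 1.\<close>

lemma norm_eq_hexnorm:
  assumes "is_norm N" and unit: "{y. N y = 1} = hexagon"
  shows "N x = hexnorm x"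
proof (rule antisym)
  have N: "\<And>x. 0 \<le> N x" "\<And>x. N x = 0 \<longleftrightarrow> x = 0" "\<And>c x. N (c *\<^sub>R x) = \<bar>c\<bar> * N x"
    "\<And>x y. N (x + y) \<le> N x + N y"
    using assms(1) by (auto simp: is_norm_def)
  have vert: "N w = 1" if "w \<in> hexagon_vertices" for w
    using vertex_in_hexagon[OF that] unit by auto
  have one: "N (vdir 0) = 1" "N (vdir 2) = 1" "N (vdir 0 - vdir 2) = 1"
    by (auto intro!: vert simp: hexagon_vertices_eq)
  have comb: "N x \<le> \<bar>p\<bar> * N y + \<bar>q\<bar> * N z" if "x = p *\<^sub>R y + q *\<^sub>R z" for p q y z
    using N(4)[of "p *\<^sub>R y" "q *\<^sub>R z"] that by (simp add: N(3))
  have "N x \<le> \<bar>hex_u x\<bar> + \<bar>hex_v x\<bar>"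
    using comb[of "hex_u x" "vdir 0" "hex_v x" "vdir 2"] one by (simp add: hex_decomp)
  moreover have "N x \<le> \<bar>hex_u x + hex_v x\<bar> + \<bar>- hex_v x\<bar>"
    using comb[of "hex_u x + hex_v x" "vdir 0" "- hex_v x" "vdir 0 - vdir 2"] one
      hex_decomp[of x] by (simp add: algebra_simps)
  moreover have "N x \<le> \<bar>hex_u x + hex_v x\<bar> + \<bar>hex_u x\<bar>"
    using comb[of "hex_u x + hex_v x" "vdir 2" "hex_u x" "vdir 0 - vdir 2"] one
      hex_decomp[of x] by (simp add: algebra_simps)
  ultimately show "N x \<le> hexnorm x"
    using hexnorm_bounds[of x] by (smt (verit))
  show "hexnorm x \<le> N x"
  proof (cases "x = 0")
    case True
    then show ?thesis using N by (simp add: hexnorm_def)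
  next
    case False
    then have pos: "0 < N x" using N(1,2)[of x] by linarith
    define y where "y = (1 / N x) *\<^sub>R x"
    have "N y = 1" using pos by (simp add: y_def N(3))
    then have "y \<in> frontier (convex hull hexagon_vertices)" using unit by (auto simp: hexagon_def)
    moreover have "closed (convex hull hexagon_vertices)"
      by (intro compact_imp_closed finite_imp_compact_convex_hull) (simp add: hexagon_vertices_def)
    ultimately have "hexnorm y \<le> 1"
      using frontier_subset_closed hexnorm_le_1_hull by blast
    then show ?thesis using pos by (simp add: y_def hexnorm_scaleR)
  qed
qed

section \<open>The cone and the trapezoid\<close>

text \<open>For a unit vector the cone condition reads \<open>cos \<theta> \<le> w $ 2\<close>,
  since arccos is decreasing. Only this weak monotonicity of \<open>f\<close> along rays is used
  later, with \<open>r = 0\<close> included.\<close>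

lemma cone_antimono:
  fixes f :: "real^2 \<Rightarrow> real"
  assumes f: "\<And>p q. q \<in> cone_at \<theta> p \<Longrightarrow> f q < f p"
    and \<theta>: "0 \<le> \<theta>" "\<theta> \<le> pi" and w: "norm w = 1" "cos \<theta> \<le> w $ 2" and r: "0 \<le> r"
  shows "f (x + r *\<^sub>R w) \<le> f x"
proof (cases "r = 0")
  case False
  have "w $ 2 \<le> 1" using w component_le_norm_cart[of w 2] by linarith
  moreover have "w \<bullet> vector [0, 1] = w $ 2" "norm (vector [0, 1] :: real^2) = 1"
    by (simp_all add: inner_vec_def sum_2 norm_vec_def L2_set_def)
  ultimately have "euclidean_angle (r *\<^sub>R w) (vector [0, 1]) = arccos (w $ 2)"
    using r w(1) False by (simp add: euclidean_angle_def)
  also have "\<dots> \<le> arccos (cos \<theta>)"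
    using w \<open>w $ 2 \<le> 1\<close> by (intro arccos_le_arccos) auto
  finally have "euclidean_angle (r *\<^sub>R w) (vector [0, 1]) \<le> \<theta>"
    using \<theta> by (simp add: arccos_cos)
  moreover have "w \<noteq> 0" using w by auto
  ultimately show ?thesis
    using f[of "x + r *\<^sub>R w" x] False by (simp add: cone_at_def)
qed simp

lemma norm_vdir [simp]: "norm (vdir i) = 1"
  by (simp add: vdir_def norm_vec_def L2_set_def sum_2)

text \<open>The \<open>t\<close>s are side lengths. Closing up the quadrilateral gives
  \<open>t4 = t2\<close> and \<open>t1 = t3 - t2\<close>, so \<open>L = (t3 + t2) / t3\<close>, and
  the diagonal is \<open>t3 *\<^sub>R vdir 2 - t2 *\<^sub>R vdir 0\<close>. Both depend only on
  \<open>K = t3 / t2\<close>.\<close>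

lemma trapezoid_slope:
  assumes "is_trapezoid \<theta> a b c d"
    and "L = polyline_length [d, a, b, c] / polyline_length [c, d]"
  obtains K \<rho> where "0 < K" "L = 1 + 1 / K" "0 < \<rho>"
    "K *\<^sub>R vdir 2 - vdir 0 = \<rho> *\<^sub>R vector [sin \<theta>, cos \<theta>]"
proof -
  obtain t1 t2 t3 t4 t5 where t: "t1 > 0" "t2 > 0" "t3 > 0" "t4 > 0" "t5 > 0"
    and e: "b - a = t1 *\<^sub>R vdir 8" "c - b = t2 *\<^sub>R vdir 6" "d - c = t3 *\<^sub>R vdir 2"
      "a - d = t4 *\<^sub>R vdir 10" "d - b = t5 *\<^sub>R vector [sin \<theta>, cos \<theta>]"
    using assms(1) unfolding is_trapezoid_def positive_multiple_def by blast
  have "(b - a) + (c - b) + (d - c) + (a - d) = 0" by simp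
  then have z: "t1 *\<^sub>R vdir 8 + t2 *\<^sub>R vdir 6 + t3 *\<^sub>R vdir 2 + t4 *\<^sub>R vdir 10 = 0"
    unfolding e .
  from arg_cong[OF z, of hex_u] arg_cong[OF z, of hex_v]
  have t4: "t4 = t2" and t1: "t1 = t3 - t2"
    by (simp_all add: vdir_6 vdir_8 vdir_10)
  have "dist d a = t4" "dist a b = t1" "dist b c = t2" "dist c d = t3"
    using t e by (simp_all add: dist_norm norm_minus_commute[of d a] norm_minus_commute[of a b]
        norm_minus_commute[of b c] norm_minus_commute[of c d])
  then have "L = 1 + 1 / (t3 / t2)"
    using t assms(2) by (simp add: t4 t1 field_simps)
  moreover have "(t3 / t2) *\<^sub>R vdir 2 - vdir 0 = (t5 / t2) *\<^sub>R vector [sin \<theta>, cos \<theta>]"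
  proof -
    have "t3 *\<^sub>R vdir 2 - t2 *\<^sub>R vdir 0 = t5 *\<^sub>R vector [sin \<theta>, cos \<theta>]"
      unfolding e(5)[symmetric] using e(2,3) by (simp add: vdir_6 algebra_simps)
    from arg_cong[OF this, of "(*\<^sub>R) (1 / t2)"] show ?thesis
      using t by (simp add: scaleR_diff_right)
  qed
  ultimately show thesis using t by (intro that[of "t3 / t2" "t5 / t2"]) auto
qed

section \<open>Lengths of piecewise smooth paths\<close>

text \<open>The derivative is taken \<open>at t\<close> and not within an interval, so that one
  integrand serves all subintervals and integrals can be split and combined.\<close>

definition hex_speed :: "(real^2 \<Rightarrow> real) \<Rightarrow> (real \<Rightarrow> real^2) \<Rightarrow> real \<Rightarrow> real" where
  "hex_speed f \<gamma> t = f (\<gamma> t) * hexnorm (vector_derivative \<gamma> (at t))"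

abbreviation hex_length :: "(real^2 \<Rightarrow> real) \<Rightarrow> (real \<Rightarrow> real^2) \<Rightarrow> real \<Rightarrow> real \<Rightarrow> real" where
  "hex_length f \<equiv> finsler_length (\<lambda>x y. f x * hexnorm y)"

abbreviation hex_dist :: "(real^2 \<Rightarrow> real) \<Rightarrow> real^2 \<Rightarrow> real^2 \<Rightarrow> real" where
  "hex_dist f \<equiv> finsler_dist (\<lambda>x y. f x * hexnorm y)"

lemma hex_length_eq: "hex_length f \<gamma> a b = integral {a..b} (hex_speed f \<gamma>)"
  unfolding finsler_length_def
  by (rule integral_spike[of "{a, b}"]) (auto simp: hex_speed_def at_within_Icc_at)

text \<open>The two curves have the same derivative predicate within the interval, so the choices
  made by \<open>vector_derivative\<close> coincide even where no derivative exists.\<close>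

lemma finsler_length_cong:
  assumes "\<And>t. t \<in> {a..b} \<Longrightarrow> \<gamma> t = \<gamma>' t"
  shows "finsler_length F \<gamma> a b = finsler_length F \<gamma>' a b"
proof -
  have "(\<gamma> has_vector_derivative w) (at t within {a..b}) \<longleftrightarrow>
      (\<gamma>' has_vector_derivative w) (at t within {a..b})" if "t \<in> {a..b}" for t w
    using has_vector_derivative_transform[OF that, of \<gamma> \<gamma>'] 
      has_vector_derivative_transform[OF that, of \<gamma>' \<gamma>] assms by metis
  then show ?thesis
    unfolding finsler_length_def vector_derivative_def
    by (intro integral_cong) (simp add: assms)
qed

section \<open>Reparametrisation, reversal and concatenation of paths\<close>

lemma smooth_on_segment_cong:
  assumes "smooth_on_segment \<gamma> u v" "\<And>t. t \<in> {u..v} \<Longrightarrow> \<gamma> t = \<gamma>' t"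
  shows "smooth_on_segment \<gamma>' u v"
proof -
  obtain D where "\<forall>t\<in>{u..v}. D 0 t = \<gamma> t"
    and D: "\<forall>n. \<forall>t\<in>{u..v}. (D n has_vector_derivative D (Suc n) t) (at t within {u..v})"
    using assms(1) unfolding smooth_on_segment_def by blast
  then have "\<forall>t\<in>{u..v}. D 0 t = \<gamma>' t" using assms(2) by simp
  with D show ?thesis unfolding smooth_on_segment_def by blast
qed

lemma smooth_on_segment_affine:
  assumes "smooth_on_segment \<gamma> u v" "\<And>t. t \<in> {u'..v'} \<Longrightarrow> m * t + k \<in> {u..v}"
  shows "smooth_on_segment (\<lambda>t. \<gamma> (m * t + k)) u' v'"
proof -
  obtain D where D: "\<And>t. t \<in> {u..v} \<Longrightarrow> D 0 t = \<gamma> t"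
    "\<And>n t. t \<in> {u..v} \<Longrightarrow> (D n has_vector_derivative D (Suc n) t) (at t within {u..v})"
    using assms(1) unfolding smooth_on_segment_def by blast
  define E where "E n t = m ^ n *\<^sub>R D n (m * t + k)" for n :: nat and t
  have "(E n has_vector_derivative E (Suc n) t) (at t within {u'..v'})" if t: "t \<in> {u'..v'}" for n t
  proof -
    have "((\<lambda>t. m * t + k) has_vector_derivative m) (at t within {u'..v'})"
      by (auto intro!: derivative_eq_intros)
    moreover have "(D n has_vector_derivative D (Suc n) (m * t + k))
        (at (m * t + k) within (\<lambda>t. m * t + k) ` {u'..v'})"
      by (rule has_vector_derivative_within_subset[OF D(2)]) (use assms(2) t in auto)
    ultimately have "(D n \<circ> (\<lambda>t. m * t + k) has_vector_derivative m *\<^sub>R D (Suc n) (m * t + k))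
        (at t within {u'..v'})"
      by (rule vector_diff_chain_within)
    then have "((\<lambda>t. m ^ n *\<^sub>R D n (m * t + k)) has_vector_derivative m ^ n *\<^sub>R m *\<^sub>R D (Suc n) (m * t + k))
        (at t within {u'..v'})"
      by (intro bounded_linear.has_vector_derivative[OF bounded_linear_scaleR_right]) (simp add: o_def)
    then show ?thesis by (simp add: E_def[abs_def] mult.commute)
  qed
  moreover have "E 0 t = \<gamma> (m * t + k)" if "t \<in> {u'..v'}" for t
    using assms(2)[OF that] D(1) by (simp add: E_def)
  ultimately show ?thesis unfolding smooth_on_segment_def by blast
qed

lemma smooth_on_segment_derivative:
  assumes "smooth_on_segment \<gamma> u v"
  obtains g where "continuous_on {u..v} g"
    "\<And>t. t \<in> {u..v} \<Longrightarrow> (\<gamma> has_vector_derivative g t) (at t within {u..v})"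
proof -
  obtain D where D: "\<And>t. t \<in> {u..v} \<Longrightarrow> D 0 t = \<gamma> t"
    "\<And>n t. t \<in> {u..v} \<Longrightarrow> (D n has_vector_derivative D (Suc n) t) (at t within {u..v})"
    using assms unfolding smooth_on_segment_def by blast
  have "(\<gamma> has_vector_derivative D 1 t) (at t within {u..v})" if "t \<in> {u..v}" for t
    using has_vector_derivative_transform[OF that _ D(2)[OF that, of 0], of \<gamma>] D(1) by simp
  moreover have "continuous_on {u..v} (D 1)"
    using D(2)[of _ 1] by (intro continuous_on_vector_derivative[where f' = "D 2"]) (simp add: numeral_2_eq_2)
  ultimately show thesis by (rule that[rotated])
qed

lemma smooth_on_segment_line: "smooth_on_segment (\<lambda>r. p + r *\<^sub>R w) u v"
proof -
  define D where "D n r = (if n = 0 then p + r *\<^sub>R w else if n = 1 then w else 0)" for n :: nat and r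
  have "(D n has_vector_derivative D (Suc n) t) (at t within {u..v})" for n t
  proof (cases "n = 0")
    case True
    then show ?thesis unfolding D_def by (auto intro!: derivative_eq_intros)
  next
    case False
    then have "D n = (\<lambda>_. if n = 1 then w else 0)" "D (Suc n) t = 0" by (auto simp: D_def)
    then show ?thesis by simp
  qed
  then show ?thesis unfolding smooth_on_segment_def by (intro exI[of _ D]) (auto simp: D_def)
qed

lemma hex_speed_affine:
  assumes m: "\<bar>m\<bar> = 1"
  shows "hex_speed f (\<lambda>t. \<gamma> (m * t + k)) t = hex_speed f \<gamma> (m * t + k)"
proof -
  have mm: "m * m = 1" using m by (metis abs_mult_self_eq mult_1)
  have chain: "((\<lambda>t. h (m * t + j)) has_vector_derivative m *\<^sub>R w) (at t)"
    if "(h has_vector_derivative w) (at (m * t + j))" for h :: "real \<Rightarrow> real^2" and j w t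
  proof -
    have "((\<lambda>t. m * t + j) has_vector_derivative m) (at t)"
      by (auto intro!: derivative_eq_intros)
    from vector_diff_chain_at[OF this that] show ?thesis by (simp add: o_def)
  qed
  show ?thesis
  proof (cases "\<exists>w. (\<gamma> has_vector_derivative w) (at (m * t + k))")
    case True
    then obtain w where w: "(\<gamma> has_vector_derivative w) (at (m * t + k))" by blast
    have "hexnorm (m *\<^sub>R w) = hexnorm w"
      using m by (cases "m = 1") (auto simp: abs_if split: if_splits)
    then show ?thesis
      using vector_derivative_at[OF w] vector_derivative_at[OF chain[OF w]]
      by (simp add: hex_speed_def)
  next
    \<comment> \<open>The affine map has an inverse of the same kind, so non-differentiability
      carries over; both occurrences of \<open>vector_derivative\<close> are then the same arbitrary
      vector, and the equation holds at break points too.\<close>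
    case False
    have "\<not> ((\<lambda>t. \<gamma> (m * t + k)) has_vector_derivative w) (at t)" for w
    proof
      assume "((\<lambda>t. \<gamma> (m * t + k)) has_vector_derivative w) (at t)"
      moreover have "m * (m * t + k) + (- m * k) = t" "\<And>s. m * (m * s + (- m * k)) + k = s"
        using mm by (simp_all add: algebra_simps mult.assoc[symmetric])
      ultimately show False
        using chain[of "\<lambda>t. \<gamma> (m * t + k)" w "m * t + k" "- m * k"] False by auto
    qed
    then show ?thesis using False by (simp add: hex_speed_def vector_derivative_def)
  qed
qed

lemma piecewise_smooth_path_shift:
  assumes "piecewise_smooth_path \<gamma> a b"
  shows "piecewise_smooth_path (\<lambda>t. \<gamma> (t + k)) (a - k) (b - k)"
proof -
  obtain n \<tau> where \<tau>: "a < b" "\<tau> (0::nat) = a" "\<tau> n = b"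
    "\<And>i. i < n \<Longrightarrow> \<tau> i < \<tau> (Suc i) \<and> smooth_on_segment \<gamma> (\<tau> i) (\<tau> (Suc i))"
    using assms unfolding piecewise_smooth_path_def by blast
  have "smooth_on_segment (\<lambda>t. \<gamma> (t + k)) (\<tau> i - k) (\<tau> (Suc i) - k)" if "i < n" for i
    using smooth_on_segment_affine[of \<gamma> "\<tau> i" "\<tau> (Suc i)" "\<tau> i - k" "\<tau> (Suc i) - k" 1 k] \<tau>(4)[OF that]
    by auto
  then show ?thesis
    unfolding piecewise_smooth_path_def using \<tau>
    by (intro conjI exI[of _ n] exI[of _ "\<lambda>i. \<tau> i - k"]) auto
qed

lemma hex_length_shift: "hex_length f (\<lambda>t. \<gamma> (t + k)) (a - k) (b - k) = hex_length f \<gamma> a b"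
proof -
  have "hex_speed f (\<lambda>t. \<gamma> (t + k)) = hex_speed f \<gamma> \<circ> (+) k"
    using hex_speed_affine[of 1 f \<gamma> k] by (auto simp: o_def add.commute)
  then show ?thesis
    unfolding hex_length_eq using integral_shift_Icc_real[of "a - k" "b - k" "hex_speed f \<gamma>" k] by simp
qed

lemma piecewise_smooth_path_reflect:
  assumes "piecewise_smooth_path \<gamma> a b"
  shows "piecewise_smooth_path (\<lambda>t. \<gamma> (- t)) (- b) (- a)"
proof -
  obtain n \<tau> where \<tau>: "a < b" "\<tau> (0::nat) = a" "\<tau> n = b"
    "\<And>i. i < n \<Longrightarrow> \<tau> i < \<tau> (Suc i) \<and> smooth_on_segment \<gamma> (\<tau> i) (\<tau> (Suc i))"
    using assms unfolding piecewise_smooth_path_def by blast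
  have "- \<tau> (n - i) < - \<tau> (n - Suc i) \<and>
      smooth_on_segment (\<lambda>t. \<gamma> (- t)) (- \<tau> (n - i)) (- \<tau> (n - Suc i))" if "i < n" for i
  proof -
    have "Suc (n - Suc i) = n - i" using that by simp
    then show ?thesis
      using \<tau>(4)[of "n - Suc i"] that
        smooth_on_segment_affine[of \<gamma> "\<tau> (n - Suc i)" "\<tau> (n - i)" "- \<tau> (n - i)" "- \<tau> (n - Suc i)" "-1" 0]
      by auto
  qed
  then show ?thesis
    unfolding piecewise_smooth_path_def using \<tau>
    by (intro conjI exI[of _ n] exI[of _ "\<lambda>i. - \<tau> (n - i)"]) auto
qed

lemma hex_length_reflect: "hex_length f (\<lambda>t. \<gamma> (- t)) (- b) (- a) = hex_length f \<gamma> a b"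
proof -
  have "hex_speed f (\<lambda>t. \<gamma> (- t)) = (\<lambda>t. hex_speed f \<gamma> (- t))"
    using hex_speed_affine[of "-1" f \<gamma> 0] by auto
  then show ?thesis unfolding hex_length_eq by simp
qed

lemma piecewise_smooth_path_join:
  assumes "piecewise_smooth_path \<gamma>1 a b" "piecewise_smooth_path \<gamma>2 b c" "\<gamma>1 b = \<gamma>2 b"
  shows "piecewise_smooth_path (\<lambda>t. if t \<le> b then \<gamma>1 t else \<gamma>2 t) a c"
proof -
  let ?\<gamma> = "\<lambda>t. if t \<le> b then \<gamma>1 t else \<gamma>2 t"
  obtain n1 \<tau>1 where 1: "a < b" "\<tau>1 (0::nat) = a" "\<tau>1 n1 = b"
    "\<And>i. i < n1 \<Longrightarrow> \<tau>1 i < \<tau>1 (Suc i) \<and> smooth_on_segment \<gamma>1 (\<tau>1 i) (\<tau>1 (Suc i))"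
    using assms(1) unfolding piecewise_smooth_path_def by blast
  obtain n2 \<tau>2 where 2: "b < c" "\<tau>2 (0::nat) = b" "\<tau>2 n2 = c"
    "\<And>i. i < n2 \<Longrightarrow> \<tau>2 i < \<tau>2 (Suc i) \<and> smooth_on_segment \<gamma>2 (\<tau>2 i) (\<tau>2 (Suc i))"
    using assms(2) unfolding piecewise_smooth_path_def by blast
  have le1: "\<tau>1 i \<le> b" if "i \<le> n1" for i
    using that
  proof (induction rule: inc_induct)
    case base
    show ?case using 1(3) by simp
  next
    case (step j)
    then show ?case using 1(4)[of j] by linarith
  qed
  have ge2: "b \<le> \<tau>2 i" if "i \<le> n2" for i
    using that
  proof (induction i)
    case 0
    show ?case using 2(2) by simp
  next
    case (Suc i)
    then show ?case using 2(4)[of i] by simp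
  qed
  define \<tau> where "\<tau> i = (if i \<le> n1 then \<tau>1 i else \<tau>2 (i - n1))" for i
  have step: "\<tau> i < \<tau> (Suc i) \<and> smooth_on_segment ?\<gamma> (\<tau> i) (\<tau> (Suc i))" if i: "i < n1 + n2" for i
  proof (cases "i < n1")
    case True
    have "smooth_on_segment ?\<gamma> (\<tau>1 i) (\<tau>1 (Suc i))"
      by (rule smooth_on_segment_cong[of \<gamma>1]) (use 1(4)[OF True] le1[of "Suc i"] True in auto)
    then show ?thesis using 1(4) True by (simp add: \<tau>_def)
  next
    case False
    then have \<tau>i: "\<tau> i = \<tau>2 (i - n1)" "\<tau> (Suc i) = \<tau>2 (Suc (i - n1))"
      using 1(3) 2(2) by (auto simp: \<tau>_def Suc_diff_le)
    have "i - n1 < n2" using False i by simp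
    have "smooth_on_segment ?\<gamma> (\<tau>2 (i - n1)) (\<tau>2 (Suc (i - n1)))"
    proof (rule smooth_on_segment_cong[of \<gamma>2])
      fix t assume "t \<in> {\<tau>2 (i - n1)..\<tau>2 (Suc (i - n1))}"
      then have "t \<le> b \<Longrightarrow> t = b" using ge2[of "i - n1"] \<open>i - n1 < n2\<close> by simp
      then show "\<gamma>2 t = ?\<gamma> t" using assms(3) by auto
    qed (use 2(4)[of "i - n1"] \<open>i - n1 < n2\<close> in auto)
    then show ?thesis using 2(4)[of "i - n1"] \<open>i - n1 < n2\<close> by (simp add: \<tau>i)
  qed
  have "\<tau> 0 = a" "\<tau> (n1 + n2) = c"
    using 1 2 by (cases n2; auto simp: \<tau>_def)+
  then show ?thesis
    unfolding piecewise_smooth_path_def using step 1(1) 2(1)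
    by (intro conjI exI[of _ "n1 + n2"] exI[of _ \<tau>]) auto
qed

section \<open>Calibrations\<close>

text \<open>An inequality on straight segments that passes to all paths by subdivision, so that no
  differentiability of \<open>H\<close> is required.\<close>

definition seg_lipschitz_on :: "(real^2) set \<Rightarrow> (real^2 \<Rightarrow> real) \<Rightarrow> (real^2 \<Rightarrow> real) \<Rightarrow> bool" where
  "seg_lipschitz_on C f H \<longleftrightarrow>
     (\<forall>x\<in>C. \<forall>y\<in>C. \<forall>M. (\<forall>z\<in>closed_segment x y. f z \<le> M) \<longrightarrow> H y - H x \<le> M * hexnorm (y - x))"

abbreviation seg_lipschitz :: "(real^2 \<Rightarrow> real) \<Rightarrow> (real^2 \<Rightarrow> real) \<Rightarrow> bool" where
  "seg_lipschitz \<equiv> seg_lipschitz_on UNIV"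

section \<open>From segments to paths\<close>

lemma smooth_hex_speed:
  assumes "\<And>t. t \<in> {u..v} \<Longrightarrow> (\<gamma> has_vector_derivative g t) (at t within {u..v})"
    and "t \<in> {u..v} - {u, v}"
  shows "hex_speed f \<gamma> t = f (\<gamma> t) * hexnorm (g t)"
proof -
  have "at t within {u..v} = at t" using assms(2) by (auto simp: at_within_Icc_at)
  then have "(\<gamma> has_vector_derivative g t) (at t)" using assms by (metis DiffD1)
  then show ?thesis by (simp add: hex_speed_def vector_derivative_at)
qed

text \<open>The norm inequality for integrals is applied to each of the three linear functionals
  whose absolute values have maximum \<open>hexnorm\<close>.\<close>

lemma hexnorm_increment_le:
  assumes der: "\<And>t. t \<in> {u..v} \<Longrightarrow> (\<gamma> has_vector_derivative g t) (at t within {u..v})"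
    and g: "continuous_on {u..v} g" and uv: "u \<le> v"
  shows "hexnorm (\<gamma> v - \<gamma> u) \<le> integral {u..v} (\<lambda>t. hexnorm (g t))"
proof -
  have fund: "(g has_integral \<gamma> v - \<gamma> u) {u..v}"
    using der uv by (intro fundamental_theorem_of_calculus)
  have bnd: "\<bar>h (\<gamma> v - \<gamma> u)\<bar> \<le> integral {u..v} (\<lambda>t. hexnorm (g t))"
    if h: "linear h" "\<And>x. \<bar>h x\<bar> \<le> hexnorm x" for h :: "real^2 \<Rightarrow> real"
  proof -
    have "((h \<circ> g) has_integral h (\<gamma> v - \<gamma> u)) {u..v}"
      using fund h(1) by (intro has_integral_linear) (auto simp: linear_linear)
    moreover have "(\<lambda>t. hexnorm (g t)) integrable_on {u..v}"
      using g by (intro integrable_continuous_real continuous_intros)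
    moreover have "norm ((h \<circ> g) t) \<le> hexnorm (g t)" for t using h(2) by simp
    ultimately show ?thesis
      using integral_norm_bound_integral[of "h \<circ> g" "{u..v}" "\<lambda>t. hexnorm (g t)"]
      by (metis has_integral_integrable_integral real_norm_def)
  qed
  have "linear hex_u" "linear hex_v" "linear (\<lambda>x. hex_u x + hex_v x)"
    by (auto intro!: linearI simp: algebra_simps)
  then show ?thesis
    by (intro hexnorm_leI bnd) (auto simp: hexnorm_def)
qed

text \<open>The interval is crossed in finitely many steps of length half of
  \<open>\<delta>\<close>, each short enough for \<open>loc\<close>.\<close>

lemma local_antimono_imp:
  fixes Q :: "real \<Rightarrow> real"
  assumes loc: "\<And>t t'. u \<le> t \<Longrightarrow> t \<le> t' \<Longrightarrow> t' \<le> v \<Longrightarrow> t' - t < \<delta> \<Longrightarrow> Q t' \<le> Q t"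
    and "0 < \<delta>" "u \<le> v"
  shows "Q v \<le> Q u"
proof -
  have "Q t \<le> Q u" if "u \<le> t" "t \<le> v" "t - u \<le> real n * (\<delta> / 2)" for n t
    using that
  proof (induction n arbitrary: t)
    case 0
    then show ?case by simp
  next
    case (Suc n)
    show ?case
    proof (cases "t - u < \<delta>")
      case True
      then show ?thesis using loc[of u t] Suc.prems by simp
    next
      case False
      then have "Q (t - \<delta> / 2) \<le> Q u"
        using Suc.prems \<open>0 < \<delta>\<close> by (intro Suc.IH) (auto simp: algebra_simps add_divide_distrib)
      moreover have "Q t \<le> Q (t - \<delta> / 2)"
        using loc[of "t - \<delta> / 2" t] False Suc.prems \<open>0 < \<delta>\<close> by simp
      ultimately show ?thesis by simp
    qed
  qed
  moreover obtain n where "v - u \<le> real n * (\<delta> / 2)"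
    using reals_Archimedean3[of "\<delta> / 2"] \<open>0 < \<delta>\<close> by (meson half_gt_zero less_imp_le)
  ultimately show ?thesis using \<open>u \<le> v\<close> by blast
qed

text \<open>On a short parameter interval the curve is replaced by its chord: \<open>f\<close> is
  nearly constant there, and the chord is no longer in \<open>hexnorm\<close> than the arc. The
  error is proportional to arc length, hence summable.\<close>

lemma seg_lipschitz_smooth:
  assumes H: "seg_lipschitz f H" and f: "continuous_on UNIV f" "\<And>x. 0 \<le> f x"
    and uv: "u < v" and sm: "smooth_on_segment \<gamma> u v"
  shows "hex_speed f \<gamma> integrable_on {u..v}"
    and "H (\<gamma> v) - H (\<gamma> u) \<le> integral {u..v} (hex_speed f \<gamma>)"
proof -
  obtain g where g: "continuous_on {u..v} g"
    "\<And>t. t \<in> {u..v} \<Longrightarrow> (\<gamma> has_vector_derivative g t) (at t within {u..v})"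
    using smooth_on_segment_derivative[OF sm] by metis
  have c\<gamma>: "continuous_on {u..v} \<gamma>" using continuous_on_vector_derivative[OF g(2)] .
  have cf: "continuous_on {u..v} (\<lambda>t. f (\<gamma> t))"
    using continuous_on_compose2[OF f(1) c\<gamma>] by simp
  have sp: "hex_speed f \<gamma> t = f (\<gamma> t) * hexnorm (g t)" if "t \<in> {u..v} - {u, v}" for t
    using g(2) that by (rule smooth_hex_speed)
  have int: "(\<lambda>t. f (\<gamma> t) * hexnorm (g t)) integrable_on {u..v}"
    "(\<lambda>t. hexnorm (g t)) integrable_on {u..v}"
    by (intro integrable_continuous_real continuous_intros cf g(1))+
  show "hex_speed f \<gamma> integrable_on {u..v}"
    by (rule integrable_spike_finite[of "{u, v}", OF _ sp int(1)]) auto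
  have eqI: "integral {u..v} (hex_speed f \<gamma>) = integral {u..v} (\<lambda>t. f (\<gamma> t) * hexnorm (g t))"
    using sp by (intro integral_spike[of "{u, v}"]) auto
  define N where "N = integral {u..v} (\<lambda>t. hexnorm (g t))"
  have "0 \<le> N" unfolding N_def by (intro integral_nonneg int) auto
  show "H (\<gamma> v) - H (\<gamma> u) \<le> integral {u..v} (hex_speed f \<gamma>)"
  proof (rule field_le_epsilon)
    fix e :: real assume "e > 0"
    \<comment> \<open>\<open>N\<close> is the \<open>hexnorm\<close> length of the whole curve; the
      total error will be \<open>2 * \<epsilon> * N\<close>, and \<open>N + 1\<close> avoids
      division by 0.\<close>
    define \<epsilon> where "\<epsilon> = e / (2 * (N + 1))"
    have \<epsilon>: "\<epsilon> > 0" "2 * \<epsilon> * N \<le> e" using \<open>e > 0\<close> \<open>0 \<le> N\<close> by (simp_all add: \<epsilon>_def field_simps)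
    \<comment> \<open>Chords leave the curve, so uniform continuity of \<open>f\<close> is taken on
      a ball, which is convex and contains them.\<close>
    have "compact (\<gamma> ` {u..v})" using c\<gamma> by (intro compact_continuous_image) auto
    then obtain R where "\<forall>x\<in>\<gamma> ` {u..v}. norm x \<le> R"
      using compact_imp_bounded bounded_iff by metis
    then have R: "\<And>t. t \<in> {u..v} \<Longrightarrow> \<gamma> t \<in> cball 0 R" by simp
    have "uniformly_continuous_on (cball 0 R) f"
      using f(1) by (intro compact_uniformly_continuous) (auto intro: continuous_on_subset)
    then obtain \<delta>1 where \<delta>1: "\<delta>1 > 0"
      "\<And>x y. x \<in> cball 0 R \<Longrightarrow> y \<in> cball 0 R \<Longrightarrow> dist y x < \<delta>1 \<Longrightarrow> dist (f y) (f x) < \<epsilon>"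
      using \<epsilon>(1) unfolding uniformly_continuous_on_def by metis
    have "uniformly_continuous_on {u..v} \<gamma>" using c\<gamma> by (intro compact_uniformly_continuous) auto
    then obtain \<delta> where \<delta>: "\<delta> > 0"
      "\<And>s t. s \<in> {u..v} \<Longrightarrow> t \<in> {u..v} \<Longrightarrow> dist t s < \<delta> \<Longrightarrow> dist (\<gamma> t) (\<gamma> s) < \<delta>1"
      using \<delta>1(1) unfolding uniformly_continuous_on_def by metis
    \<comment> \<open>One \<open>\<epsilon>\<close> pays for replacing \<open>f\<close> on the chord
      by its value at the left end, the other for passing from there to
      \<open>f (\<gamma> s)\<close>.\<close>
    define k where "k s = (f (\<gamma> s) + 2 * \<epsilon>) * hexnorm (g s)" for s
    have ck: "continuous_on {u..v} k" unfolding k_def by (intro continuous_intros cf g(1))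
    have "H (\<gamma> v) - integral {u..v} k \<le> H (\<gamma> u) - integral {u..u} k"
    proof (rule local_antimono_imp[where \<delta> = \<delta> and Q = "\<lambda>t. H (\<gamma> t) - integral {u..t} k"])
      fix t t' assume t: "u \<le> t" "t \<le> t'" "t' \<le> v" "t' - t < \<delta>"
      have sub: "{t..t'} \<subseteq> {u..v}" using t by auto
      have near: "dist (\<gamma> s) (\<gamma> t) < \<delta>1" if "s \<in> {t..t'}" for s
        using that t by (intro \<delta>(2)) (auto simp: dist_real_def)
      have "f z \<le> f (\<gamma> t) + \<epsilon>" if z: "z \<in> closed_segment (\<gamma> t) (\<gamma> t')" for z
      proof -
        have "dist z (\<gamma> t) < \<delta>1"
          using dist_in_closed_segment[OF z] near[of t'] t by (auto simp: dist_commute)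
        moreover have "z \<in> cball 0 R"
          using closed_segment_subset[OF R R convex_cball, of t t'] z t by auto
        ultimately have "dist (f z) (f (\<gamma> t)) < \<epsilon>" using R[of t] t by (intro \<delta>1(2)) auto
        then show ?thesis by (auto simp: dist_real_def)
      qed
      then have "H (\<gamma> t') - H (\<gamma> t) \<le> (f (\<gamma> t) + \<epsilon>) * hexnorm (\<gamma> t' - \<gamma> t)"
        using H unfolding seg_lipschitz_on_def by blast
      also have "\<dots> \<le> (f (\<gamma> t) + \<epsilon>) * integral {t..t'} (\<lambda>s. hexnorm (g s))"
        using t f(2)[of "\<gamma> t"] \<epsilon>(1) continuous_on_subset[OF g(1) sub]
          has_vector_derivative_within_subset[OF g(2) sub]
        by (intro mult_left_mono hexnorm_increment_le) auto
      also have "\<dots> = integral {t..t'} (\<lambda>s. (f (\<gamma> t) + \<epsilon>) * hexnorm (g s))"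
        by simp
      also have "\<dots> \<le> integral {t..t'} k"
      proof (rule integral_le)
        show "(\<lambda>s. (f (\<gamma> t) + \<epsilon>) * hexnorm (g s)) integrable_on {t..t'}"
          using g(1) sub by (intro integrable_continuous_real continuous_intros) (auto intro: continuous_on_subset)
        show "k integrable_on {t..t'}"
          using ck sub by (intro integrable_continuous_real) (auto intro: continuous_on_subset)
        fix s assume s: "s \<in> {t..t'}"
        have "dist (f (\<gamma> s)) (f (\<gamma> t)) < \<epsilon>"
          using near[OF s] R[of t] R[of s] s t by (intro \<delta>1(2)) auto
        then have "f (\<gamma> t) + \<epsilon> \<le> f (\<gamma> s) + 2 * \<epsilon>" by (auto simp: dist_real_def)
        then show "(f (\<gamma> t) + \<epsilon>) * hexnorm (g s) \<le> k s"
          unfolding k_def by (intro mult_right_mono) auto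
      qed
      also have "\<dots> = integral {u..t'} k - integral {u..t} k"
        using Henstock_Kurzweil_Integration.integral_combine[of u t t' k] t ck
          integrable_continuous_real[of u t' k] continuous_on_subset[OF ck, of "{u..t'}"] by simp
      finally show "H (\<gamma> t') - integral {u..t'} k \<le> H (\<gamma> t) - integral {u..t} k" by simp
    qed (use \<delta>(1) uv in auto)
    moreover have "integral {u..v} k = integral {u..v} (hex_speed f \<gamma>) + 2 * \<epsilon> * N"
      unfolding eqI N_def k_def distrib_right
      using int by (subst integral_add) (auto intro: integrable_on_mult_right)
    ultimately show "H (\<gamma> v) - H (\<gamma> u) \<le> integral {u..v} (hex_speed f \<gamma>) + e"
      using \<epsilon>(2) by simp
  qed
qed

lemma seg_lipschitz_path:
  assumes H: "seg_lipschitz f H" and f: "continuous_on UNIV f" "\<And>x. 0 \<le> f x"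
    and path: "piecewise_smooth_path \<gamma> a b"
  shows "hex_speed f \<gamma> integrable_on {a..b}" and "H (\<gamma> b) - H (\<gamma> a) \<le> hex_length f \<gamma> a b"
proof -
  obtain n \<tau> where \<tau>: "\<tau> (0::nat) = a" "\<tau> n = b"
    "\<And>i. i < n \<Longrightarrow> \<tau> i < \<tau> (Suc i) \<and> smooth_on_segment \<gamma> (\<tau> i) (\<tau> (Suc i))"
    using path unfolding piecewise_smooth_path_def by blast
  have "\<tau> 0 \<le> \<tau> i \<and> hex_speed f \<gamma> integrable_on {\<tau> 0..\<tau> i} \<and>
      H (\<gamma> (\<tau> i)) - H (\<gamma> (\<tau> 0)) \<le> integral {\<tau> 0..\<tau> i} (hex_speed f \<gamma>)" if "i \<le> n" for i
    using that
  proof (induction i)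
    case 0
    then show ?case using integrable_on_refl[of "hex_speed f \<gamma>" "\<tau> 0"] by simp
  next
    case (Suc i)
    then have IH: "\<tau> 0 \<le> \<tau> i" "hex_speed f \<gamma> integrable_on {\<tau> 0..\<tau> i}"
      "H (\<gamma> (\<tau> i)) - H (\<gamma> (\<tau> 0)) \<le> integral {\<tau> 0..\<tau> i} (hex_speed f \<gamma>)" by auto
    have lt: "\<tau> i < \<tau> (Suc i)" and sm: "smooth_on_segment \<gamma> (\<tau> i) (\<tau> (Suc i))"
      using \<tau>(3) Suc.prems by auto
    note new = seg_lipschitz_smooth[OF H f lt sm]
    have int: "hex_speed f \<gamma> integrable_on {\<tau> 0..\<tau> (Suc i)}"
      using Henstock_Kurzweil_Integration.integrable_combine[OF _ _ IH(2) new(1)] IH(1) lt by simp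
    show ?case
      using Henstock_Kurzweil_Integration.integral_combine[OF _ _ int, of "\<tau> i"] IH lt new int by simp
  qed
  from this[of n] show "hex_speed f \<gamma> integrable_on {a..b}" "H (\<gamma> b) - H (\<gamma> a) \<le> hex_length f \<gamma> a b"
    unfolding hex_length_eq \<tau> by auto
qed

section \<open>The distance\<close>

text \<open>As a trivial calibration, this yields integrability of the speed and nonnegativity of
  lengths.\<close>

lemma seg_lipschitz_0: "(\<And>x. 0 \<le> f x) \<Longrightarrow> seg_lipschitz f (\<lambda>_. 0)"
  unfolding seg_lipschitz_on_def by (auto intro!: mult_nonneg_nonneg intro: order_trans)

context
  fixes f :: "real^2 \<Rightarrow> real"
  assumes cont: "continuous_on UNIV f" and nonneg: "\<And>x. 0 \<le> f x"
begin

lemma hex_speed_integrable: "piecewise_smooth_path \<gamma> a b \<Longrightarrow> hex_speed f \<gamma> integrable_on {a..b}"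
  using seg_lipschitz_path(1)[OF seg_lipschitz_0 cont nonneg] nonneg by blast

lemma hex_length_nonneg: "piecewise_smooth_path \<gamma> a b \<Longrightarrow> 0 \<le> hex_length f \<gamma> a b"
  using seg_lipschitz_path(2)[OF seg_lipschitz_0 cont nonneg] nonneg by fastforce

lemma hex_length_line:
  assumes "a < b"
  shows "piecewise_smooth_path (\<lambda>r. p + r *\<^sub>R w) a b"
    and "hex_length f (\<lambda>r. p + r *\<^sub>R w) a b = integral {a..b} (\<lambda>r. f (p + r *\<^sub>R w) * hexnorm w)"
proof -
  show "piecewise_smooth_path (\<lambda>r. p + r *\<^sub>R w) a b"
    unfolding piecewise_smooth_path_def using assms smooth_on_segment_line
    by (intro conjI exI[of _ 1] exI[of _ "\<lambda>i. if i = 0 then a else b"]) auto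
  have "vector_derivative (\<lambda>r. p + r *\<^sub>R w) (at t) = w" for t
    by (intro vector_derivative_at) (auto intro!: derivative_eq_intros)
  then show "hex_length f (\<lambda>r. p + r *\<^sub>R w) a b = integral {a..b} (\<lambda>r. f (p + r *\<^sub>R w) * hexnorm w)"
    by (simp add: hex_length_eq hex_speed_def[abs_def])
qed

lemma hex_dist_le_length:
  assumes "piecewise_smooth_path \<gamma> a b"
  shows "hex_dist f (\<gamma> a) (\<gamma> b) \<le> hex_length f \<gamma> a b"
  unfolding finsler_dist_def
proof (rule cInf_lower)
  show "bdd_below {hex_length f \<gamma>' t0 s0 |\<gamma>' t0 s0.
      piecewise_smooth_path \<gamma>' t0 s0 \<and> \<gamma>' t0 = \<gamma> a \<and> \<gamma>' s0 = \<gamma> b}"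
    by (rule bdd_belowI[of _ 0]) (auto intro: hex_length_nonneg)
qed (use assms in auto)

lemma hex_dist_geI:
  assumes "\<And>\<gamma> a b. piecewise_smooth_path \<gamma> a b \<Longrightarrow> \<gamma> a = p \<Longrightarrow> \<gamma> b = q \<Longrightarrow> C \<le> hex_length f \<gamma> a b"
  shows "C \<le> hex_dist f p q"
  unfolding finsler_dist_def
proof (rule cInf_greatest)
  have "\<exists>\<gamma> t0 s0. piecewise_smooth_path \<gamma> t0 s0 \<and> \<gamma> t0 = p \<and> \<gamma> s0 = q"
    using hex_length_line(1)[of 0 1 p "q - p"]
    by (intro exI[of _ "\<lambda>r. p + r *\<^sub>R (q - p)"] exI[of _ 0] exI[of _ 1]) simp
  then show "{hex_length f \<gamma> t0 s0 |\<gamma> t0 s0.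
      piecewise_smooth_path \<gamma> t0 s0 \<and> \<gamma> t0 = p \<and> \<gamma> s0 = q} \<noteq> {}"
    by blast
qed (use assms in auto)

lemma hex_dist_ge:
  assumes "seg_lipschitz f H"
  shows "H q - H p \<le> hex_dist f p q"
proof (rule hex_dist_geI)
  fix \<gamma> a b assume "piecewise_smooth_path \<gamma> a b" "\<gamma> a = p" "\<gamma> b = q"
  then show "H q - H p \<le> hex_length f \<gamma> a b"
    using seg_lipschitz_path(2)[OF assms cont nonneg, of \<gamma> a b] by simp
qed

lemma hex_dist_commute_le: "hex_dist f p q \<le> hex_dist f q p"
proof (rule hex_dist_geI)
  fix \<gamma> a b assume \<gamma>: "piecewise_smooth_path \<gamma> a b" "\<gamma> a = q" "\<gamma> b = p"
  show "hex_dist f p q \<le> hex_length f \<gamma> a b"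
    using hex_dist_le_length[OF piecewise_smooth_path_reflect[OF \<gamma>(1)]] \<gamma>(2,3)
    by (simp add: hex_length_reflect)
qed

lemma hex_dist_triangle: "hex_dist f p r \<le> hex_dist f p q + hex_dist f q r"
proof -
  have "hex_dist f p r \<le> hex_length f \<gamma>1 a b + hex_length f \<gamma>2 c d"
    if 1: "piecewise_smooth_path \<gamma>1 a b" "\<gamma>1 a = p" "\<gamma>1 b = q"
      and 2: "piecewise_smooth_path \<gamma>2 c d" "\<gamma>2 c = q" "\<gamma>2 d = r" for \<gamma>1 \<gamma>2 a b c d
  proof -
    define \<gamma>3 where "\<gamma>3 = (\<lambda>t. \<gamma>2 (t + (c - b)))"
    define e where "e = d - (c - b)"
    have 3: "piecewise_smooth_path \<gamma>3 b e" "\<gamma>3 b = q" "\<gamma>3 e = r"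
      "hex_length f \<gamma>3 b e = hex_length f \<gamma>2 c d"
      using piecewise_smooth_path_shift[OF 2(1), of "c - b"] hex_length_shift[of f \<gamma>2 "c - b" c d] 2
      by (simp_all add: \<gamma>3_def e_def)
    define \<gamma> where "\<gamma> = (\<lambda>t. if t \<le> b then \<gamma>1 t else \<gamma>3 t)"
    have path: "piecewise_smooth_path \<gamma> a e"
      unfolding \<gamma>_def using piecewise_smooth_path_join[OF 1(1) 3(1)] 1 3 by simp
    have ab: "a < b" "b < e" using 1(1) 3(1) by (auto simp: piecewise_smooth_path_def)
    have "hex_length f \<gamma> a e = hex_length f \<gamma> a b + hex_length f \<gamma> b e"
      using Henstock_Kurzweil_Integration.integral_combine[OF _ _ hex_speed_integrable[OF path], of b] ab
      by (simp add: hex_length_eq)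
    also have "hex_length f \<gamma> a b = hex_length f \<gamma>1 a b"
      by (rule finsler_length_cong) (simp add: \<gamma>_def)
    also have "hex_length f \<gamma> b e = hex_length f \<gamma>3 b e"
      using 1(3) 3(2) by (intro finsler_length_cong) (auto simp: \<gamma>_def order.antisym)
    finally show ?thesis
      using hex_dist_le_length[OF path] ab 1(2) 3 by (simp add: \<gamma>_def)
  qed
  \<comment> \<open>The two infima are taken one after the other, with the remaining length moved to
    the left-hand side.\<close>
  then have "hex_dist f p r - hex_length f \<gamma>2 c d \<le> hex_dist f p q"
    if "piecewise_smooth_path \<gamma>2 c d" "\<gamma>2 c = q" "\<gamma>2 d = r" for \<gamma>2 c d
    using that by (intro hex_dist_geI) (simp add: diff_le_eq)
  then have "hex_dist f p r - hex_dist f p q \<le> hex_dist f q r"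
    by (intro hex_dist_geI) (simp add: algebra_simps)
  then show ?thesis by simp
qed

end

text \<open>Since \<open>f \<ge> 1\<close>, the coordinates \<open>hex_u\<close> and
  \<open>hex_v\<close> are themselves calibrations; distance 0 therefore forces equal
  coordinates.\<close>

lemma Metric_space_hex_dist:
  assumes cont: "continuous_on UNIV f" and ge: "\<And>x. 1 \<le> f x"
  shows "Metric_space UNIV (hex_dist f)"
proof
  have nn: "0 \<le> f x" for x using ge[of x] by linarith
  have lin: "seg_lipschitz f h"
    if h: "\<And>x y. h y - h x \<le> hexnorm (y - x)" for h :: "real^2 \<Rightarrow> real"
    unfolding seg_lipschitz_on_def
  proof (intro ballI allI impI)
    fix x y M assume "\<forall>z\<in>closed_segment x y. f z \<le> M"
    then have "1 \<le> M" using ge[of x] ends_in_segment(1)[of x y] by (meson order_trans)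
    then have "1 * hexnorm (y - x) \<le> M * hexnorm (y - x)" by (intro mult_right_mono) auto
    then show "h y - h x \<le> M * hexnorm (y - x)" using h[where x = x and y = y] by linarith
  qed
  show nonneg: "0 \<le> hex_dist f x y" for x y
    using hex_dist_ge[OF cont nn seg_lipschitz_0[of f]] nn by force
  show sym: "hex_dist f x y = hex_dist f y x" for x y
    using hex_dist_commute_le[OF cont nn] by (intro antisym)
  show "hex_dist f x z \<le> hex_dist f x y + hex_dist f y z" for x y z
    using hex_dist_triangle[OF cont nn] .
  show "hex_dist f x y = 0 \<longleftrightarrow> x = y" for x y
  proof
    assume 0: "hex_dist f x y = 0"
    have "h y - h x \<le> 0 \<and> h x - h y \<le> 0"
      if "\<And>x y. h y - h x \<le> hexnorm (y - x)" for h :: "real^2 \<Rightarrow> real"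
      using hex_dist_ge[OF cont nn lin[OF that], where p = x and q = y]
        hex_dist_ge[OF cont nn lin[OF that], where p = y and q = x] 0 sym[of x y] by auto
    from this[of hex_u] this[of hex_v] show "x = y"
      by (intro hex_eqI) (use hexnorm_bounds hex_uv_simps in \<open>metis antisym diff_le_0_iff_le\<close>)+
  next
    assume "x = y"
    \<comment> \<open>The constant path, a line with direction 0, has length 0.\<close>
    then show "hex_dist f x y = 0"
      using hex_dist_le_length[OF cont nn hex_length_line(1)[OF cont nn, of 0 1 x 0]] nonneg[of x y]
        hex_length_line(2)[OF cont nn, of 0 1 x 0]
      by (simp add: hexnorm_def)
  qed
qed

text \<open>A segment crossing \<open>h = 0\<close> is cut at the crossing point:
  \<open>hexnorm\<close> is additive over the two collinear pieces, and the bound \<open>M\<close>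
  is inherited by both. This allows calibrations to be checked region by region.\<close>

lemma seg_lipschitz_on_glue:
  fixes h :: "real^2 \<Rightarrow> real"
  assumes "convex C" and h: "linear h"
    and neg: "seg_lipschitz_on {x \<in> C. h x \<le> 0} f H" and pos: "seg_lipschitz_on {x \<in> C. 0 \<le> h x} f H"
  shows "seg_lipschitz_on C f H"
  unfolding seg_lipschitz_on_def
proof (intro ballI allI impI)
  fix x y M assume C: "x \<in> C" "y \<in> C" and M: "\<forall>z\<in>closed_segment x y. f z \<le> M"
  have half: "H y' - H x' \<le> M * hexnorm (y' - x')"
    if "x' \<in> C" "y' \<in> C" "h x' \<le> 0 \<and> h y' \<le> 0 \<or> 0 \<le> h x' \<and> 0 \<le> h y'"
      "closed_segment x' y' \<subseteq> closed_segment x y" for x' y'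
  proof -
    have M': "\<forall>z\<in>closed_segment x' y'. f z \<le> M" using that(4) M by blast
    from that(3) show ?thesis
    proof
      assume "h x' \<le> 0 \<and> h y' \<le> 0"
      then show ?thesis using neg that(1,2) M' unfolding seg_lipschitz_on_def by simp
    next
      assume "0 \<le> h x' \<and> 0 \<le> h y'"
      then show ?thesis using pos that(1,2) M' unfolding seg_lipschitz_on_def by simp
    qed
  qed
  show "H y - H x \<le> M * hexnorm (y - x)"
  proof (cases "h x \<le> 0 \<and> h y \<le> 0 \<or> 0 \<le> h x \<and> 0 \<le> h y")
    case True
    then show ?thesis using half[of x y] C by simp
  next
    case False
    \<comment> \<open>The zero of \<open>h\<close> along the segment; here \<open>h x\<close> and
      \<open>h y\<close> have strictly opposite signs.\<close>
    define s where "s = h x / (h x - h y)"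
    define z where "z = x + s *\<^sub>R (y - x)"
    have s: "0 \<le> s" "s \<le> 1" using False by (auto simp: s_def divide_simps)
    have "h z = h x + s * (h y - h x)"
      using h by (simp add: z_def linear_add linear_diff linear_scale)
    then have hz: "h z = 0" using False by (auto simp: s_def field_simps)
    have z: "z \<in> closed_segment x y"
      unfolding z_def using s by (auto simp: in_segment algebra_simps intro!: exI[of _ s])
    then have "z \<in> C" using closed_segment_subset[OF C \<open>convex C\<close>] by auto
    have "H z - H x \<le> M * hexnorm (z - x)" "H y - H z \<le> M * hexnorm (y - z)"
      by (rule half; use z C \<open>z \<in> C\<close> hz in \<open>auto simp: subset_closed_segment\<close>)+
    moreover have "z - x = s *\<^sub>R (y - x)" "y - z = (1 - s) *\<^sub>R (y - x)"
      by (simp_all add: z_def algebra_simps)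
    ultimately have "H z - H x \<le> M * (s * hexnorm (y - x))" "H y - H z \<le> M * ((1 - s) * hexnorm (y - x))"
      using s by (simp_all add: hexnorm_scaleR)
    then show ?thesis by (simp add: algebra_simps)
  qed
qed

text \<open>By the mean value theorem on the segment, the increment is
  \<open>p w + g (l z) * l w\<close> with \<open>w = y - x\<close> and some \<open>z\<close> on it.
  Then \<open>dual\<close> bounds it by \<open>g (l z) * hexnorm w\<close>, and \<open>level\<close>
  gives \<open>g (l z) \<le> f z \<le> M\<close>.\<close>

lemma seg_lipschitz_on_region:
  assumes "convex C" and p: "linear p" and l: "linear l"
    and E: "\<And>r. (E has_real_derivative g r) (at r)"
    and H: "\<And>x. x \<in> C \<Longrightarrow> H x = p x + E (l x)"
    and level: "\<And>x. x \<in> C \<Longrightarrow> g (l x) \<le> f x"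
    and dual: "\<And>r w. p w + g r * l w \<le> g r * hexnorm w"
  shows "seg_lipschitz_on C f H"
  unfolding seg_lipschitz_on_def
proof (intro ballI allI impI)
  fix x y M assume C: "x \<in> C" "y \<in> C" and M: "\<forall>z\<in>closed_segment x y. f z \<le> M"
  have der: "((\<lambda>t. E (l x + t * l (y - x))) has_real_derivative g (l x + t * l (y - x)) * l (y - x)) (at t)" for t
    by (rule DERIV_chain2[OF E]) (auto intro!: derivative_eq_intros)
  from MVT2[of 0 1, OF _ der] obtain t where t: "0 < t" "t < 1"
    and e: "E (l x + l (y - x)) - E (l x) = g (l x + t * l (y - x)) * l (y - x)"
    by auto
  define z where "z = x + t *\<^sub>R (y - x)"
  have z: "z \<in> closed_segment x y"
    unfolding z_def using t by (auto simp: in_segment algebra_simps intro!: exI[of _ t])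
  then have "z \<in> C" using closed_segment_subset[OF C \<open>convex C\<close>] by auto
  have lz: "l z = l x + t * l (y - x)"
    using l by (simp add: z_def linear_add linear_scale)
  have "H y - H x = p (y - x) + g (l z) * l (y - x)"
    using e H C l p by (simp add: lz linear_diff)
  also have "\<dots> \<le> g (l z) * hexnorm (y - x)" by (rule dual)
  also have "\<dots> \<le> M * hexnorm (y - x)"
    using level[OF \<open>z \<in> C\<close>] M z by (intro mult_right_mono) force+
  finally show "H y - H x \<le> M * hexnorm (y - x)" .
qed

lemma antiderivative_UNIV:
  fixes g :: "real \<Rightarrow> real"
  assumes "continuous_on UNIV g"
  obtains E where "\<And>r. (E has_real_derivative g r) (at r)"
proof -
  have "\<exists>E. \<forall>r::real. - \<infinity> < ereal r \<longrightarrow> ereal r < \<infinity> \<longrightarrow> (E has_vector_derivative g r) (at r)"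
    using assms by (intro einterval_antiderivative) (auto simp: continuous_on_eq_continuous_at)
  then show thesis
    using that by (auto simp: has_real_derivative_iff_has_vector_derivative)
qed

text \<open>The upper bound that matches \<open>hex_dist_ge\<close>: the segment has unit speed for
  \<open>hexnorm\<close>, so its length is the integral of \<open>g\<close>.\<close>

lemma hex_dist_line_le:
  assumes cont: "continuous_on UNIV f" and nonneg: "\<And>x. 0 \<le> f x"
    and E: "\<And>r. (E has_real_derivative g r) (at r)"
    and g: "\<And>r. a \<le> r \<Longrightarrow> r \<le> b \<Longrightarrow> f (p + r *\<^sub>R w) = g r" and w: "hexnorm w = 1" and ab: "a < b"
  shows "hex_dist f (p + a *\<^sub>R w) (p + b *\<^sub>R w) \<le> E b - E a"
proof -
  have "hex_length f (\<lambda>r. p + r *\<^sub>R w) a b = integral {a..b} g"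
    unfolding hex_length_line(2)[OF cont nonneg ab] w using g by (intro integral_cong) simp
  also have "(g has_integral E b - E a) {a..b}"
    using ab E by (intro fundamental_theorem_of_calculus)
      (auto simp: has_real_derivative_iff_has_vector_derivative[symmetric] intro: DERIV_subset)
  then have "integral {a..b} g = E b - E a" by (rule integral_unique)
  finally show ?thesis
    using hex_dist_le_length[OF cont nonneg hex_length_line(1)[OF cont nonneg ab, of p w]] by simp
qed

section \<open>A branching geodesic\<close>

context
  fixes f :: "real^2 \<Rightarrow> real" and K :: real
  assumes cont: "continuous_on UNIV f" and f_ge: "\<And>x. 1 \<le> f x"
    and K: "0 < K" and f_le: "\<And>x. (f x - 1) * K \<le> 1"
    and mono_2: "\<And>x r. 0 \<le> r \<Longrightarrow> f (x + r *\<^sub>R vdir 2) \<le> f x"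
    and mono_10: "\<And>x r. 0 \<le> r \<Longrightarrow> f (x + r *\<^sub>R (vdir 0 - vdir 2)) \<le> f x"
    and mono_K: "\<And>x r. 0 \<le> r \<Longrightarrow> f (x + r *\<^sub>R (K *\<^sub>R vdir 2 - vdir 0)) \<le> f x"
begin

text \<open>With the end point as a variable, the remaining equation is settled in coordinates by
  \<open>hex_eqI\<close>.\<close>

lemma f_mono_2: "0 \<le> r \<Longrightarrow> y = x + r *\<^sub>R vdir 2 \<Longrightarrow> f y \<le> f x"
  and f_mono_10: "0 \<le> r \<Longrightarrow> y = x + r *\<^sub>R (vdir 0 - vdir 2) \<Longrightarrow> f y \<le> f x"
  and f_mono_K: "0 \<le> r \<Longrightarrow> y = x + r *\<^sub>R (K *\<^sub>R vdir 2 - vdir 0) \<Longrightarrow> f y \<le> f x"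
  by (simp_all add: mono_2 mono_10 mono_K)

lemma f_nonneg: "0 \<le> f x"
  using f_ge[of x] by linarith

lemma linear_hex: "linear hex_u" "linear hex_v" "linear (\<lambda>x. hex_u x + hex_v x)"
  "linear (\<lambda>x. - (K * hex_u x))" "linear (\<lambda>x. K * hex_u x + hex_v x)" "linear (\<lambda>x. 0 :: real)"
  by (rule linearI; simp add: algebra_simps)+

lemma convex_hex:
  "convex {x. hex_u x \<le> 0}" "convex {x. 0 \<le> hex_u x}"
  "convex {x. hex_v x \<le> 0}" "convex {x. 0 \<le> hex_v x}"
  "convex {x. K * hex_u x + hex_v x \<le> 0}" "convex {x. 0 \<le> K * hex_u x + hex_v x}"
proof -
  have "convex {x. h x \<le> 0}" "convex {x. 0 \<le> h x}" if "linear h" for h :: "real^2 \<Rightarrow> real"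
    using convex_linear_vimage[OF that, of "{..0}"] convex_linear_vimage[OF that, of "{0..}"]
    by (auto simp: vimage_def)
  then show "convex {x. hex_u x \<le> 0}" "convex {x. 0 \<le> hex_u x}"
    "convex {x. hex_v x \<le> 0}" "convex {x. 0 \<le> hex_v x}"
    "convex {x. K * hex_u x + hex_v x \<le> 0}" "convex {x. 0 \<le> K * hex_u x + hex_v x}"
    using linear_hex by blast+
qed

text \<open>The level lines run from both sides up to the vertical axis, along \<open>vdir 2\<close>
  from the left and \<open>vdir 0 - vdir 2\<close> from the right. The functionals
  \<open>hex_u\<close> and \<open>hex_u + hex_v\<close> are bounded by \<open>hexnorm\<close>, so no
  correction is necessary.\<close>

lemma vertical_calibration:
  assumes E: "\<And>r. (E has_real_derivative f (r *\<^sub>R vdir 0)) (at r)"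
  shows "seg_lipschitz f (\<lambda>x. E (hex_u x + max 0 (hex_v x)))"
proof (rule seg_lipschitz_on_glue[of _ hex_v])
  show "seg_lipschitz_on {x \<in> UNIV. hex_v x \<le> 0} f (\<lambda>x. E (hex_u x + max 0 (hex_v x)))"
  proof (rule seg_lipschitz_on_region[of _ "\<lambda>_. 0" hex_u E])
    fix x assume "x \<in> {x \<in> UNIV. hex_v x \<le> 0}"
    then show "f (hex_u x *\<^sub>R vdir 0) \<le> f x"
      by (intro f_mono_2[of "- hex_v x"]) (auto intro!: hex_eqI)
  qed (use E convex_hex in \<open>auto simp: linear_hex intro!: mult_left_mono f_nonneg hexnorm_bounds\<close>)
  show "seg_lipschitz_on {x \<in> UNIV. 0 \<le> hex_v x} f (\<lambda>x. E (hex_u x + max 0 (hex_v x)))"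
  proof (rule seg_lipschitz_on_region[of _ "\<lambda>_. 0" "\<lambda>x. hex_u x + hex_v x" E])
    fix x assume "x \<in> {x \<in> UNIV. 0 \<le> hex_v x}"
    then show "f ((hex_u x + hex_v x) *\<^sub>R vdir 0) \<le> f x"
      by (intro f_mono_10[of "hex_v x"]) (auto intro!: hex_eqI)
  qed (use E convex_hex in \<open>auto simp: linear_hex intro!: mult_left_mono f_nonneg hexnorm_bounds\<close>)
qed (auto simp: linear_hex)

text \<open>Both legs have \<open>hexnorm\<close> speed 1, so \<open>f (bent r)\<close> is the
  length density. Moreover \<open>lam (bent r) = psi (bent r) = r\<close>: the correction
  \<open>psi - lam\<close> vanishes on the curve.\<close>

definition bent :: "real \<Rightarrow> real^2" where
  "bent r = min r 0 *\<^sub>R vdir 0 + max r 0 *\<^sub>R vdir 2"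

text \<open>On the half-plane above the second leg, the level lines of \<open>lam\<close> have the extreme direction
  \<open>K *\<^sub>R vdir 2 - vdir 0\<close> of the cone.  As a functional \<open>lam\<close> then has large norm there; this is
  compensated by splitting \<open>f = 1 + (f - 1)\<close>, using \<open>lam\<close> for \<open>f - 1\<close> only and the functional \<open>psi\<close>,
  which does not increase upwards, for the constant part.  The bound \<open>L\<close> on \<open>f\<close> is what makes the
  two parts balance.\<close>

definition lam :: "real^2 \<Rightarrow> real" where
  "lam x = min (hex_u x) 0 + max 0 (K * max (hex_u x) 0 + hex_v x)"

definition psi :: "real^2 \<Rightarrow> real" where
  "psi x = hex_v x + min (hex_u x) 0"

text \<open>The signs of \<open>hex_u\<close>, and then of \<open>hex_v\<close> or
  \<open>K * hex_u + hex_v\<close>, cut the plane into four regions on which \<open>lam\<close> and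
  \<open>psi\<close> are linear.\<close>

lemma bent_calibration:
  assumes E: "\<And>r. (E has_real_derivative f (bent r)) (at r)"
  shows "seg_lipschitz f (\<lambda>x. psi x - lam x + E (lam x))"
proof -
  define H where "H x = psi x - lam x + E (lam x)" for x
  have nonpos_u: "seg_lipschitz_on {x. hex_u x \<le> 0} f H"
  proof (rule seg_lipschitz_on_glue[of _ hex_v])
    show "seg_lipschitz_on {x \<in> {x. hex_u x \<le> 0}. hex_v x \<le> 0} f H"
    proof (rule seg_lipschitz_on_region[of _ hex_v hex_u E])
      fix x assume x: "x \<in> {x \<in> {x. hex_u x \<le> 0}. hex_v x \<le> 0}"
      then show "f (bent (hex_u x)) \<le> f x"
        by (intro f_mono_2[of "- hex_v x"]) (auto intro!: hex_eqI simp: bent_def)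
      show "H x = hex_v x + E (hex_u x)" using x by (simp add: H_def psi_def lam_def)
    next
      fix r w
      \<comment> \<open>The left side of \<open>dual\<close> is
        \<open>(hex_u w + hex_v w) + (f (bent r) - 1) * hex_u w\<close>.\<close>
      have "(f (bent r) - 1) * hex_u w \<le> (f (bent r) - 1) * hexnorm w"
        using f_ge by (intro mult_left_mono hexnorm_bounds) (simp add: f_ge)
      then show "hex_v w + f (bent r) * hex_u w \<le> f (bent r) * hexnorm w"
        using hexnorm_bounds(3)[of w] by (simp add: algebra_simps)
    qed (use E convex_hex in \<open>auto simp: linear_hex Collect_conj_eq intro!: convex_Int\<close>)
    show "seg_lipschitz_on {x \<in> {x. hex_u x \<le> 0}. 0 \<le> hex_v x} f H"
    proof (rule seg_lipschitz_on_region[of _ "\<lambda>_. 0" "\<lambda>x. hex_u x + hex_v x" E])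
      fix x assume x: "x \<in> {x \<in> {x. hex_u x \<le> 0}. 0 \<le> hex_v x}"
      show "f (bent (hex_u x + hex_v x)) \<le> f x"
      \<comment> \<open>The level line meets the first leg or the second, according to the sign of
        the level.\<close>
      proof (cases "hex_u x + hex_v x \<le> 0")
        case True
        then show ?thesis
          using x by (intro f_mono_10[of "hex_v x"]) (auto intro!: hex_eqI simp: bent_def)
      next
        case False
        then show ?thesis
          using x by (intro f_mono_10[of "- hex_u x"]) (auto intro!: hex_eqI simp: bent_def)
      qed
      show "H x = 0 + E (hex_u x + hex_v x)" using x by (simp add: H_def psi_def lam_def add.commute)
    qed (use E convex_hex in \<open>auto simp: linear_hex Collect_conj_eq
          intro!: convex_Int mult_left_mono f_nonneg hexnorm_bounds\<close>)
  qed (auto simp: linear_hex convex_hex)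
  have nonneg_u: "seg_lipschitz_on {x. 0 \<le> hex_u x} f H"
  proof (rule seg_lipschitz_on_glue[of _ "\<lambda>x. K * hex_u x + hex_v x"])
    show "seg_lipschitz_on {x \<in> {x. 0 \<le> hex_u x}. K * hex_u x + hex_v x \<le> 0} f H"
    proof (rule seg_lipschitz_on_region[of _ hex_v "\<lambda>_. 0" E])
      fix x assume x: "x \<in> {x \<in> {x. 0 \<le> hex_u x}. K * hex_u x + hex_v x \<le> 0}"
      \<comment> \<open>In this wedge \<open>lam\<close> is constantly 0, so every point must be
        compared with the corner: first along the extreme direction to the line
        \<open>hex_u = 0\<close>, then along \<open>vdir 2\<close>.\<close>
      have "f 0 \<le> f (- (K * hex_u x + hex_v x) *\<^sub>R (- vdir 2))"
        using x by (intro f_mono_2[of "- (K * hex_u x + hex_v x)"]) (auto intro!: hex_eqI)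
      also have "\<dots> \<le> f x"
        using x by (intro f_mono_K[of "hex_u x"]) (auto intro!: hex_eqI)
      finally show "f (bent 0) \<le> f x" by (simp add: bent_def)
      show "H x = hex_v x + E 0" using x by (simp add: H_def psi_def lam_def)
    next
      fix r w
      have "hex_v w \<le> 1 * hexnorm w" using hexnorm_bounds(2)[of w] by simp
      also have "\<dots> \<le> f (bent r) * hexnorm w" using f_ge by (intro mult_right_mono) auto
      finally show "hex_v w + f (bent r) * 0 \<le> f (bent r) * hexnorm w" by simp
    qed (use E convex_hex in \<open>auto simp: linear_hex Collect_conj_eq intro!: convex_Int\<close>)
    show "seg_lipschitz_on {x \<in> {x. 0 \<le> hex_u x}. 0 \<le> K * hex_u x + hex_v x} f H"
    proof (rule seg_lipschitz_on_region[of _ "\<lambda>x. - (K * hex_u x)" "\<lambda>x. K * hex_u x + hex_v x" E])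
      fix x assume x: "x \<in> {x \<in> {x. 0 \<le> hex_u x}. 0 \<le> K * hex_u x + hex_v x}"
      then show "f (bent (K * hex_u x + hex_v x)) \<le> f x"
        by (intro f_mono_K[of "hex_u x"]) (auto intro!: hex_eqI simp: bent_def)
      show "H x = - (K * hex_u x) + E (K * hex_u x + hex_v x)"
        using x by (simp add: H_def psi_def lam_def)
    next
      fix r w
      \<comment> \<open>The left side of \<open>dual\<close> equals
        \<open>m * K * (hex_u w + hex_v w) + (1 + m - m * K) * hex_v w\<close>. The weights are
        nonnegative because \<open>m * K \<le> 1\<close>, and they add up to
        \<open>f (bent r)\<close>.\<close>
      define m where "m = f (bent r) - 1"
      have m: "0 \<le> m * K" "m * K \<le> 1 + m" "f (bent r) = 1 + m"
        using f_ge[of "bent r"] f_le[of "bent r"] K by (auto simp: m_def)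
      have "m * K * (hex_u w + hex_v w) \<le> m * K * hexnorm w"
        "(1 + m - m * K) * hex_v w \<le> (1 + m - m * K) * hexnorm w"
        using m by (intro mult_left_mono hexnorm_bounds; simp)+
      then show "- (K * hex_u w) + f (bent r) * (K * hex_u w + hex_v w) \<le> f (bent r) * hexnorm w"
        unfolding m(3) by (simp add: algebra_simps)
    qed (use E convex_hex in \<open>auto simp: linear_hex Collect_conj_eq intro!: convex_Int\<close>)
  qed (auto simp: linear_hex convex_hex)
  show ?thesis
    using seg_lipschitz_on_glue[of UNIV hex_u f H] nonpos_u nonneg_u
    by (simp add: linear_hex H_def[abs_def])
qed

section \<open>Two prolongations of equal length\<close>

lemma hexnorm_vdir: "hexnorm (vdir 0) = 1" "hexnorm (vdir 2) = 1"
  by (simp_all add: hexnorm_def)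

lemma continuous_f_comp: "continuous_on UNIV \<sigma> \<Longrightarrow> continuous_on UNIV (\<lambda>r::real. f (\<sigma> r))"
  using continuous_on_compose2[OF cont] by blast

lemma not_Busemann_hex_dist: "\<not> Busemann_G_space UNIV (hex_dist f)"
proof
  assume G: "Busemann_G_space UNIV (hex_dist f)"
  interpret Metric_space UNIV "hex_dist f" using cont f_ge by (rule Metric_space_hex_dist)
  have "continuous_on UNIV (\<lambda>r. f (r *\<^sub>R vdir 0))" "continuous_on UNIV (\<lambda>r. f (bent r))"
    unfolding bent_def by (intro continuous_f_comp continuous_intros)+
  then obtain V B where V: "\<And>r. (V has_real_derivative f (r *\<^sub>R vdir 0)) (at r)"
    and B: "\<And>r. (B has_real_derivative f (bent r)) (at r)"
    using antiderivative_UNIV by metis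
  obtain z where z: "V 1 - V 0 = f (z *\<^sub>R vdir 0)"
    using MVT2[of 0 1 V, OF _ V] by auto
  define D where "D = V 1 - V 0"
  have D: "1 \<le> D" using z f_ge by (simp add: D_def)
  \<comment> \<open>As \<open>f \<ge> 1\<close>, the second leg up to parameter \<open>D\<close> has
    length at least \<open>D\<close>; the intermediate value theorem then finds \<open>t\<close>
    where the length is exactly \<open>D\<close>.\<close>
  obtain z' where z': "B D - B 0 = D * f (bent z')"
    using MVT2[of 0 D B, OF _ B] D by auto
  have "D * 1 \<le> D * f (bent z')" using D f_ge by (intro mult_left_mono) auto
  then have "B 0 + D \<le> B D" using z' by simp
  moreover have "continuous_on {0..D} B"
    by (rule DERIV_continuous_on[OF DERIV_subset[OF B subset_UNIV]])
  ultimately obtain t where t: "0 \<le> t" "t \<le> D" "B t = B 0 + D"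
    using IVT'[of B 0 "B 0 + D" D] D by auto
  have "t \<noteq> 0" using t D by auto
  with t have "0 < t" by simp
  let ?a = "- vdir 0" and ?b = "0 :: real^2" and ?c1 = "vdir 0" and ?c2 = "t *\<^sub>R vdir 2"
  note line = hex_dist_line_le[OF cont f_nonneg, where p = 0]
  \<comment> \<open>The legs bound the two distances from above, the calibration bounds their sum
    from below by the same number, and the triangle inequality forces equality throughout.\<close>
  have "hex_dist f ?a ?b \<le> V 0 - V (- 1)" "hex_dist f ?b ?c1 \<le> D"
    using line[OF V, of "- 1" 0 "vdir 0"] line[OF V, of 0 1 "vdir 0"] by (simp_all add: D_def hexnorm_vdir)
  moreover have "V 0 - V (- 1) + D \<le> hex_dist f ?a ?c1"
    using hex_dist_ge[OF cont f_nonneg vertical_calibration[OF V], of ?c1 ?a] by (simp add: D_def)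
  ultimately have 1: "hex_dist f ?a ?b + hex_dist f ?b ?c1 = hex_dist f ?a ?c1" "hex_dist f ?b ?c1 = D"
    using triangle[of ?a ?b ?c1] by auto
  have "hex_dist f ?a ?b \<le> B 0 - B (- 1)" "hex_dist f ?b ?c2 \<le> D"
    using line[OF B, of "- 1" 0 "vdir 0"] line[OF B, of 0 t "vdir 2"] \<open>0 < t\<close> t
    by (simp_all add: hexnorm_vdir bent_def)
  moreover have "B 0 - B (- 1) + D \<le> hex_dist f ?a ?c2"
    using hex_dist_ge[OF cont f_nonneg bent_calibration[OF B], of ?c2 ?a] \<open>0 < t\<close> t
    by (simp add: psi_def lam_def)
  ultimately have 2: "hex_dist f ?a ?b + hex_dist f ?b ?c2 = hex_dist f ?a ?c2" "hex_dist f ?b ?c2 = D"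
    using triangle[of ?a ?b ?c2] by auto
  have ne: "x \<noteq> y" if "hex_u x \<noteq> hex_u y \<or> hex_v x \<noteq> hex_v y" for x y using that by auto
  have "?a \<noteq> ?b" "?c1 \<noteq> ?a" "?c1 \<noteq> ?b" "?c2 \<noteq> ?a" "?c2 \<noteq> ?b" "?c1 \<noteq> ?c2"
    using \<open>0 < t\<close> by (intro ne; simp)+
  moreover have "\<forall>a b c1 c2. c1 \<in> UNIV - {a, b} \<and> c2 \<in> UNIV - {a, b} \<and> a \<noteq> b \<and>
      hex_dist f a b + hex_dist f b c1 = hex_dist f a c1 \<and>
      hex_dist f a b + hex_dist f b c2 = hex_dist f a c2 \<and> hex_dist f b c1 = hex_dist f b c2
      \<longrightarrow> c1 = c2"
    using G unfolding Busemann_G_space_def by blast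
  ultimately show False using 1 2 by (metis DiffI UNIV_I empty_iff insert_iff)
qed

end

theorem mainTheorem4:
  fixes F\<^sub>0 :: "real^2 \<Rightarrow> real"
    and \<theta> L :: real
    and a b c d :: "real^2"
    and f :: "real^2 \<Rightarrow> real"
    and F :: "real^2 \<Rightarrow> real^2 \<Rightarrow> real"
  assumes "is_norm F\<^sub>0" and "{y. F\<^sub>0 y = 1} = hexagon"
    and "\<theta> \<in> {pi / 3 <.. pi / 2}"
    and "is_trapezoid \<theta> a b c d"
    and "L = polyline_length [d, a, b, c] / polyline_length [c, d]"
    and "continuous_on UNIV f"
    and "\<And>x. 0 < f x"
    and "\<And>p q. q \<in> cone_at \<theta> p \<Longrightarrow> f q < f p"
    and "\<And>x. f x \<in> {1 <..< L}"
    and "\<And>x y. F x y = f x * F\<^sub>0 y"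
  shows "Metric_space UNIV (finsler_dist F) \<and> \<not> Busemann_G_space UNIV (finsler_dist F)"
proof -
  have F: "F = (\<lambda>x y. f x * hexnorm y)"
    using assms(10) norm_eq_hexnorm[OF assms(1,2)] by (auto simp: fun_eq_iff)
  obtain K \<rho> where K: "0 < K" "L = 1 + 1 / K" "0 < \<rho>"
    "K *\<^sub>R vdir 2 - vdir 0 = \<rho> *\<^sub>R vector [sin \<theta>, cos \<theta>]"
    using trapezoid_slope[OF assms(4,5)] .
  have \<theta>: "0 \<le> \<theta>" "\<theta> \<le> pi" "cos \<theta> \<le> 1 / 2"
    using assms(3) cos_monotone_0_pi_le[of "pi / 3" \<theta>] by (auto simp: cos_60)
  \<comment> \<open>Both directions have height 1/2, the cosine of pi/3.\<close>
  have up: "cos \<theta> \<le> vdir 2 $ 2" "cos \<theta> \<le> vdir 10 $ 2"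
    using \<theta>(3) by (simp_all add: vdir_10 vdir_0 vdir_2)
  have f_ge: "1 \<le> f x" for x using assms(9)[of x] by simp
  have "(f x - 1) * K \<le> 1" for x
    using assms(9)[of x] K by (simp add: field_simps)
  moreover have "f (x + r *\<^sub>R vdir 2) \<le> f x" if "0 \<le> r" for x r
    using that \<theta> up by (intro cone_antimono[OF assms(8)]) auto
  moreover have "f (x + r *\<^sub>R (vdir 0 - vdir 2)) \<le> f x" if "0 \<le> r" for x r
    unfolding vdir_10[symmetric]
    using that \<theta> up by (intro cone_antimono[OF assms(8)]) auto
  moreover have "f (x + r *\<^sub>R (K *\<^sub>R vdir 2 - vdir 0)) \<le> f x" if "0 \<le> r" for x r
    unfolding K(4) scaleR_scaleR using that \<theta> K(3)
    by (intro cone_antimono[OF assms(8)]) (auto simp: norm_vec_def L2_set_def sum_2)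
  ultimately have "\<not> Busemann_G_space UNIV (hex_dist f)"
    using not_Busemann_hex_dist[of f K] assms(6) f_ge K(1) by blast
  then show ?thesis
    using Metric_space_hex_dist[OF assms(6) f_ge] F by simp
qed

end
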